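(* Let $G$ be a finitely generated virtually nilpotent group which is not virtually abelian. Then any subgroup $H$ of $G$ isomorphic to the Heisenberg group $H_3(\mathbb{Z})$ is a non-foldable subset of $G$. In particular $G$ has a Schreier growth gap $n^4$.
   Context: $H_3(\mathbb{Z})=\langle a,b,c : [a,b]=c,\ [a,c]=[b,c]=1\rangle$ is the Heisenberg group over the integers. Let $G$ be a finitely generated group, $S$ a finite symmetric generating set, and $|\cdot|_S$ the word length. A $G$-set is a non-empty set with a $G$-action (not necessarily transitive); it is faithful if only the identity of $G$ acts trivially. The growth of the action of $G$ on a $G$-set $X$ is $\mathrm{vol}_{G,X}(n)=\max_{x\in X}|\{gx : g\in G,\ |g|_S\le n\}|$. For functions $f,g$ from $\mathbb{N}$ to the non-negative reals, $f(n)\preccurlyeq g(n)$ (equivalently $g(n)\succcurlyeq f(n)$) means that there is a constant $C>0$ such that $f(n)\le C g(Cn)$ for all sufficiently large $n$; $f\simeq g$ means $f\preccurlyeq g$ and $g\preccurlyeq f$. Up to $\simeq$, $\mathrm{vol}_{G,X}$ does not depend on $S$. The group $G$ has a Schreier growth gap $f(n)$ if every faithful $G$-set $X$ satisfies $\mathrm{vol}_{G,X}(n)\succcurlyeq f(n)$. A subset $\mathcal{L}$ of a group $G$ is non-foldable if for every faithful $G$-set $X$ and every finite subset $\Sigma\subset\mathcal{L}$ there exists $x\in X$ such that the map $\Sigma\to X$, $g\mapsto gx$, is injective. *)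

theory Defs
  imports Complex_Main "HOL-Algebra.Generated_Groups" "HOL-Algebra.Group_Action"
begin

section \<open>Groups given by a presentation\<close>

text \<open>A word over the generators \<open>'g\<close> is a list of letters; \<open>(x, True)\<close> stands for the
  generator \<open>x\<close> and \<open>(x, False)\<close> for its formal inverse.\<close>

type_synonym 'g word = "('g \<times> bool) list"

definition gen :: "'g \<Rightarrow> 'g word"
  where "gen x = [(x, True)]"

definition word_inv :: "'g word \<Rightarrow> 'g word"
  where "word_inv w = rev (map (\<lambda>(x, b). (x, \<not> b)) w)"

definition word_comm :: "'g word \<Rightarrow> 'g word \<Rightarrow> 'g word"
  where "word_comm u v = u @ v @ word_inv u @ word_inv v"

text \<open>A relation \<open>u = v\<close> is given as the pair \<open>(u, v)\<close>. The relation \<open>pres_eq R\<close> is the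
  congruence on words generated by \<open>R\<close> together with the free cancellations, so its quotient
  is the group with the given generators and relations \<open>R\<close>.\<close>

inductive pres_eq :: "('g word \<times> 'g word) set \<Rightarrow> 'g word \<Rightarrow> 'g word \<Rightarrow> bool"
  for R :: "('g word \<times> 'g word) set"
  where
    pres_rel: "(u, v) \<in> R \<Longrightarrow> pres_eq R u v"
  | pres_cancel: "pres_eq R [(x, b), (x, \<not> b)] []"
  | pres_refl: "pres_eq R u u"
  | pres_sym: "pres_eq R u v \<Longrightarrow> pres_eq R v u"
  | pres_trans: "pres_eq R u v \<Longrightarrow> pres_eq R v w \<Longrightarrow> pres_eq R u w"
  | pres_app: "pres_eq R u u' \<Longrightarrow> pres_eq R v v' \<Longrightarrow> pres_eq R (u @ v) (u' @ v')"

definition pres_class :: "('g word \<times> 'g word) set \<Rightarrow> 'g word \<Rightarrow> 'g word set"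
  where "pres_class R u = {v. pres_eq R u v}"

definition presented_group :: "('g word \<times> 'g word) set \<Rightarrow> 'g word set monoid"
  where "presented_group R =
    \<lparr>carrier = range (pres_class R),
     monoid.mult = (\<lambda>A B. \<Union>u\<in>A. \<Union>v\<in>B. pres_class R (u @ v)),
     one = pres_class R []\<rparr>"

lemma pres_class_eq_iff: "pres_class R u = pres_class R v \<longleftrightarrow> pres_eq R u v"
  unfolding pres_class_def set_eq_iff mem_Collect_eq by (meson pres_refl pres_sym pres_trans)

lemma presented_group_mult:
  "pres_class R u \<otimes>\<^bsub>presented_group R\<^esub> pres_class R v = pres_class R (u @ v)"
proof -
  have *: "pres_class R (u' @ v') = pres_class R (u @ v)"
    if "u' \<in> pres_class R u" "v' \<in> pres_class R v" for u' v'
    using that unfolding pres_class_eq_iff by (simp add: pres_class_def pres_app pres_sym)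
  have "u \<in> pres_class R u" "v \<in> pres_class R v"
    by (simp_all add: pres_class_def pres_refl)
  then have "(\<Union>u'\<in>pres_class R u. \<Union>v'\<in>pres_class R v. pres_class R (u' @ v')) = pres_class R (u @ v)"
    using * by blast
  then show ?thesis
    by (simp add: presented_group_def)
qed

lemma pres_eq_word_inv: "pres_eq R (word_inv u @ u) []"
proof (induction u)
  case Nil
  show ?case by (simp add: word_inv_def pres_refl)
next
  case (Cons l u)
  obtain x b where l: "l = (x, b)" by (cases l)
  have "pres_eq R [(x, \<not> b), (x, b)] []"
    using pres_cancel[of R x "\<not> b"] by simp
  then have "pres_eq R ([(x, \<not> b), (x, b)] @ u) ([] @ u)"
    by (rule pres_app[OF _ pres_refl])
  then have "pres_eq R (word_inv u @ [(x, \<not> b), (x, b)] @ u) (word_inv u @ [] @ u)"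
    by (rule pres_app[OF pres_refl])
  then have "pres_eq R (word_inv (l # u) @ l # u) (word_inv u @ u)"
    by (simp add: word_inv_def l)
  then show ?case using Cons.IH by (rule pres_trans)
qed

lemma group_presented_group: "group (presented_group R)"
proof (rule groupI)
  fix A assume "A \<in> carrier (presented_group R)"
  then obtain u where A: "A = pres_class R u" by (auto simp: presented_group_def)
  have one: "\<one>\<^bsub>presented_group R\<^esub> = pres_class R []"
    by (simp add: presented_group_def)
  show "\<one>\<^bsub>presented_group R\<^esub> \<otimes>\<^bsub>presented_group R\<^esub> A = A"
    by (simp add: one A presented_group_mult)
  have "pres_class R (word_inv u) \<otimes>\<^bsub>presented_group R\<^esub> A = \<one>\<^bsub>presented_group R\<^esub>"
    by (simp add: one A presented_group_mult pres_class_eq_iff pres_eq_word_inv)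
  then show "\<exists>B\<in>carrier (presented_group R). B \<otimes>\<^bsub>presented_group R\<^esub> A = \<one>\<^bsub>presented_group R\<^esub>"
    by (auto simp: presented_group_def)
next
  show "\<one>\<^bsub>presented_group R\<^esub> \<in> carrier (presented_group R)"
    by (simp add: presented_group_def)
next
  fix A B assume "A \<in> carrier (presented_group R)" "B \<in> carrier (presented_group R)"
  then obtain u v where "A = pres_class R u" "B = pres_class R v"
    by (auto simp: presented_group_def)
  then have "A \<otimes>\<^bsub>presented_group R\<^esub> B = pres_class R (u @ v)"
    by (simp add: presented_group_mult)
  then show "A \<otimes>\<^bsub>presented_group R\<^esub> B \<in> carrier (presented_group R)"
    by (simp add: presented_group_def)
next
  fix A B C assume "A \<in> carrier (presented_group R)" "B \<in> carrier (presented_group R)"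
    "C \<in> carrier (presented_group R)"
  then obtain u v w where "A = pres_class R u" "B = pres_class R v" "C = pres_class R w"
    by (auto simp: presented_group_def)
  then show "A \<otimes>\<^bsub>presented_group R\<^esub> B \<otimes>\<^bsub>presented_group R\<^esub> C =
      A \<otimes>\<^bsub>presented_group R\<^esub> (B \<otimes>\<^bsub>presented_group R\<^esub> C)"
    by (simp add: presented_group_mult)
qed

datatype heis_gen = GenA | GenB | GenC

definition heisenberg_group :: "heis_gen word set monoid"
  where "heisenberg_group = presented_group
    {(word_comm (gen GenA) (gen GenB), gen GenC),
     (word_comm (gen GenA) (gen GenC), []),
     (word_comm (gen GenB) (gen GenC), [])}"


section \<open>Virtual properties and word length\<close>

primrec lower_central_series :: "('a, 'm) monoid_scheme \<Rightarrow> nat \<Rightarrow> 'a set"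
  where
    "lower_central_series G 0 = carrier G"
  | "lower_central_series G (Suc i) = generate G
      {x \<otimes>\<^bsub>G\<^esub> y \<otimes>\<^bsub>G\<^esub> inv\<^bsub>G\<^esub> x \<otimes>\<^bsub>G\<^esub> inv\<^bsub>G\<^esub> y | x y.
        x \<in> lower_central_series G i \<and> y \<in> carrier G}"

definition nilpotent_group :: "('a, 'm) monoid_scheme \<Rightarrow> bool"
  where "nilpotent_group G \<longleftrightarrow> group G \<and> (\<exists>n. lower_central_series G n = {\<one>\<^bsub>G\<^esub>})"

definition finite_index_subgroup :: "'a set \<Rightarrow> ('a, 'm) monoid_scheme \<Rightarrow> bool"
  where "finite_index_subgroup K G \<longleftrightarrow> subgroup K G \<and> finite (rcosets\<^bsub>G\<^esub> K)"

definition virtually_nilpotent :: "('a, 'm) monoid_scheme \<Rightarrow> bool"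
  where "virtually_nilpotent G \<longleftrightarrow>
    (\<exists>K. finite_index_subgroup K G \<and> nilpotent_group (G\<lparr>carrier := K\<rparr>))"

definition virtually_abelian :: "('a, 'm) monoid_scheme \<Rightarrow> bool"
  where "virtually_abelian G \<longleftrightarrow>
    (\<exists>K. finite_index_subgroup K G \<and> comm_group (G\<lparr>carrier := K\<rparr>))"

definition finitely_generated :: "('a, 'm) monoid_scheme \<Rightarrow> bool"
  where "finitely_generated G \<longleftrightarrow>
    (\<exists>S. finite S \<and> S \<subseteq> carrier G \<and> generate G S = carrier G)"

definition finite_symmetric_generating_set :: "('a, 'm) monoid_scheme \<Rightarrow> 'a set \<Rightarrow> bool"
  where "finite_symmetric_generating_set G S \<longleftrightarrow>
    finite S \<and> S \<subseteq> carrier G \<and> (\<forall>s\<in>S. inv\<^bsub>G\<^esub> s \<in> S) \<and> generate G S = carrier G"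

definition word_length :: "('a, 'm) monoid_scheme \<Rightarrow> 'a set \<Rightarrow> 'a \<Rightarrow> nat"
  where "word_length G S g =
    (LEAST n. \<exists>ws. set ws \<subseteq> S \<and> length ws = n \<and> foldr (\<otimes>\<^bsub>G\<^esub>) ws \<one>\<^bsub>G\<^esub> = g)"

definition word_ball :: "('a, 'm) monoid_scheme \<Rightarrow> 'a set \<Rightarrow> nat \<Rightarrow> 'a set"
  where "word_ball G S n = {g \<in> carrier G. word_length G S g \<le> n}"


section \<open>Faithful group actions, growth, and non-foldable subsets\<close>

definition faithful_G_set :: "('a, 'm) monoid_scheme \<Rightarrow> 'x set \<Rightarrow> ('a \<Rightarrow> 'x \<Rightarrow> 'x) \<Rightarrow> bool"
  where "faithful_G_set G X \<phi> \<longleftrightarrow> X \<noteq> {} \<and> faithful_action G X \<phi>"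

lemma faithful_action_iff:
  "faithful_action G X \<phi> \<longleftrightarrow>
    group_action G X \<phi> \<and> (\<forall>g\<in>carrier G. (\<forall>x\<in>X. \<phi> g x = x) \<longrightarrow> g = \<one>\<^bsub>G\<^esub>)"
proof (cases "group_action G X \<phi>")
  case True
  then interpret group_action G X \<phi> .
  interpret group_hom G "BijGroup X" \<phi> by (rule group_hom)
  have "\<phi> g = \<one>\<^bsub>BijGroup X\<^esub> \<longleftrightarrow> (\<forall>x\<in>X. \<phi> g x = x)" if "g \<in> carrier G" for g
  proof -
    have "\<phi> g \<in> extensional X"
      using hom_closed[OF that] by (simp add: BijGroup_def Bij_def)
    moreover have "\<one>\<^bsub>BijGroup X\<^esub> = (\<lambda>x\<in>X. x)"
      by (simp add: BijGroup_def)
    ultimately show ?thesis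
      by (metis extensionalityI restrict_apply' restrict_extensional)
  qed
  then have "inj_on \<phi> (carrier G) \<longleftrightarrow> (\<forall>g\<in>carrier G. (\<forall>x\<in>X. \<phi> g x = x) \<longrightarrow> g = \<one>\<^bsub>G\<^esub>)"
    unfolding inj_on_one_iff by blast
  then show ?thesis
    using True unfolding faithful_action_def faithful_action_axioms_def by blast
next
  case False
  then show ?thesis by (auto simp: faithful_action_def)
qed

text \<open>The sets under the maximum are orbits of a word ball, so their cardinalities are bounded
  when \<open>S\<close> is a finite generating set.\<close>

definition action_growth ::
    "('a, 'm) monoid_scheme \<Rightarrow> 'a set \<Rightarrow> 'x set \<Rightarrow> ('a \<Rightarrow> 'x \<Rightarrow> 'x) \<Rightarrow> nat \<Rightarrow> nat"
  where "action_growth G S X \<phi> n =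
    Max ((\<lambda>x. card ((\<lambda>g. \<phi> g x) ` word_ball G S n)) ` X)"

definition growth_le :: "(nat \<Rightarrow> real) \<Rightarrow> (nat \<Rightarrow> real) \<Rightarrow> bool"
  where "growth_le f g \<longleftrightarrow> (\<exists>C::nat. C > 0 \<and> (\<forall>\<^sub>F n in sequentially. f n \<le> real C * g (C * n)))"

text \<open>HOL cannot quantify over types inside a formula, so the type of points of the
  \<open>G\<close>-sets is an argument of the next two definitions. A statement about \<open>TYPE('x)\<close>
  with \<open>'x\<close> a type variable is a statement about \<open>G\<close>-sets of arbitrary type.\<close>

definition has_schreier_growth_gap ::
    "'x itself \<Rightarrow> ('a, 'm) monoid_scheme \<Rightarrow> (nat \<Rightarrow> real) \<Rightarrow> bool"
  where "has_schreier_growth_gap _ G f \<longleftrightarrow>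
    (\<forall>S (X :: 'x set) \<phi>. finite_symmetric_generating_set G S \<longrightarrow> faithful_G_set G X \<phi> \<longrightarrow>
      growth_le f (\<lambda>n. real (action_growth G S X \<phi> n)))"

definition non_foldable :: "'x itself \<Rightarrow> ('a, 'm) monoid_scheme \<Rightarrow> 'a set \<Rightarrow> bool"
  where "non_foldable _ G L \<longleftrightarrow> L \<subseteq> carrier G \<and>
    (\<forall>(X :: 'x set) \<phi>. faithful_G_set G X \<phi> \<longrightarrow>
      (\<forall>\<Sigma>. finite \<Sigma> \<longrightarrow> \<Sigma> \<subseteq> L \<longrightarrow> (\<exists>x\<in>X. inj_on (\<lambda>g. \<phi> g x) \<Sigma>)))"

end

theory Submission
  imports Defs "HOL-Algebra.Multiplicative_Group"
begin

text \<open>Let \<open>a, b\<close> have a commutator \<open>c = [a, b]\<close> that commutes with both and has infinite order. In a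
  faithful action some point \<open>x\<close> is moved by \<open>c\<^bsup>m!\<^esup>\<close>, hence by \<open>c, \<dots>, c\<^sup>m\<close>. Conjugating a
  non-central \<open>g = a\<^sup>u b\<^sup>v c\<^sup>w\<close> by elements of the subgroup multiplies it by powers of \<open>c\<close>; if \<open>m\<close> is
  large, each such \<open>g\<close> from a given finite set has at most one conjugate in the family
  \<open>g c\<^bsup>p(Mu-v)\<^esup>\<close> (\<open>p \<le> n\<close>) that fixes \<open>x\<close>. By the pigeonhole principle some translate
  \<open>a\<^sup>p b\<^bsup>Mp\<^esup> x\<close> is moved by the whole finite set. Only the action of the Heisenberg subgroup matters here.

  The \<open>n\<^sup>4\<close> elements \<open>a\<^sup>i b\<^sup>j c\<^sup>k\<close> with \<open>i, j < n\<close>, \<open>k < n\<^sup>2\<close> lie in a ball of radius \<open>O(n)\<close>, which yields the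
  growth gap as soon as such a pair exists. If a finitely generated nilpotent group \<open>N\<close> of class
  \<open>j + 2\<close> has none, then for \<open>x\<close> in the \<open>j\<close>-th term of the lower central series (numbered from \<open>0\<close>) the
  homomorphism \<open>[x, -]\<close> into the centre has torsion, hence finite, image. The centralizer of that term
  thus has finite index, and its class is smaller; by induction \<open>N\<close> is virtually abelian.\<close>

section \<open>Actions of the integer Heisenberg group\<close>

type_synonym int_triple = "int \<times> int \<times> int"

text \<open>\<open>(i, j, k)\<close> stands for \<open>a\<^sup>i b\<^sup>j c\<^sup>k\<close>. The relations \<open>[a, b] = c\<close> and \<open>c\<close> central give
  \<open>b\<^sup>j a\<^sup>i = a\<^sup>i b\<^sup>j c\<^bsup>-ij\<^esup>\<close>, whence the correction term in the product.\<close>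

fun hmul :: "int_triple \<Rightarrow> int_triple \<Rightarrow> int_triple" where
  "hmul (i, j, k) (i', j', k') = (i + i', j + j', k + k' - j * i')"

fun hinv :: "int_triple \<Rightarrow> int_triple" where
  "hinv (i, j, k) = (- i, - j, - k - i * j)"

lemma hmul_hinv: "hmul (hinv t) t = (0, 0, 0)"
  by (cases t) (simp add: algebra_simps)

text \<open>The action is given by its values on triples, so that it can be pulled back along
  \<open>heis_map\<close>; faithfulness enters through \<open>moves\<close>. If every translate of
  \<open>x0\<close> used below failed, one pair of triples would collide at two of them, and a small
  central power would fix \<open>x0\<close>.\<close>

lemma heisenberg_action_injective_point:
  fixes A :: "int_triple \<Rightarrow> 'x \<Rightarrow> 'x" and X :: "'x set"
  assumes closed: "\<And>t x. x \<in> X \<Longrightarrow> A t x \<in> X"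
    and one: "\<And>x. x \<in> X \<Longrightarrow> A (0, 0, 0) x = x"
    and mul: "\<And>s t x. x \<in> X \<Longrightarrow> A (hmul s t) x = A s (A t x)"
    and moves: "\<And>N::nat. N > 0 \<Longrightarrow> \<exists>x\<in>X. A (0, 0, int N) x \<noteq> x"
    and fin: "finite \<Sigma>"
  shows "\<exists>x\<in>X. inj_on (\<lambda>t. A t x) \<Sigma>"
proof -
  define T where "T = fst ` \<Sigma> \<union> (fst \<circ> snd) ` \<Sigma> \<union> (snd \<circ> snd) ` \<Sigma>"
  \<comment> \<open>Inserting \<open>0\<close> makes the maximum exist for empty
    \<open>\<Sigma>\<close> and gives \<open>B \<ge> 0\<close>.\<close>
  define B where "B = Max (insert 0 (abs ` T))"
  have finT: "finite (insert 0 (abs ` T))"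
    using fin by (simp add: T_def)
  have B: "\<bar>i\<bar> \<le> B \<and> \<bar>j\<bar> \<le> B \<and> \<bar>k\<bar> \<le> B" if "(i, j, k) \<in> \<Sigma>" for i j k
  proof -
    have "i \<in> T" "j \<in> T" "k \<in> T"
      using that by (force simp: T_def)+
    then show ?thesis using finT by (auto simp: B_def intro!: Max_ge)
  qed
  have B0: "B \<ge> 0" using finT by (auto simp: B_def intro!: Max_ge)
  \<comment> \<open>Conjugating \<open>(u, v, w)\<close> by \<open>(p, M p, 0)\<close> shifts \<open>w\<close> by \<open>p (M u - v)\<close>. As \<open>M\<close> exceeds \<open>\<bar>u\<bar>\<close> and
    \<open>\<bar>v\<bar>\<close>, the slope \<open>M u - v\<close> vanishes only for \<open>u = v = 0\<close>, i.e. for central elements.\<close>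
  define M where "M = 2 * B + 1"
  define n where "n = card (\<Sigma> \<times> \<Sigma>)"
  \<comment> \<open>\<open>m\<close> exceeds the absolute values of both kinds of central exponents
    met below: differences \<open>k - k'\<close>, at most \<open>2 * B\<close>, and differences of
    shifts, at most \<open>n * (M * M + M)\<close>.\<close>
  define m where "m = nat (int n * (M * M + M) + 2 * B + 1)"
  have m: "int m = int n * (M * M + M) + 2 * B + 1"
    using B0 by (simp add: m_def M_def)
  \<comment> \<open>A point moved by \<open>c\<^bsup>m!\<^esup>\<close> is moved by \<open>c\<^sup>r\<close> whenever \<open>0 < \<bar>r\<bar> \<le> m\<close>.\<close>
  obtain x0 where x0: "x0 \<in> X" "A (0, 0, int (fact m)) x0 \<noteq> x0"
    using moves[of "fact m"] by auto
  have central: "r = 0 \<or> \<bar>r\<bar> > int m" if fixd: "A (0, 0, r) x0 = x0" for r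
  proof (rule ccontr)
    assume "\<not> ?thesis"
    then have r: "r \<noteq> 0" "\<bar>r\<bar> \<le> int m" by auto
    have "A (0, 0, - r) x0 = x0"
      using mul[OF x0(1), of "(0, 0, - r)" "(0, 0, r)"] fixd one[OF x0(1)] by simp
    with fixd have abs: "A (0, 0, \<bar>r\<bar>) x0 = x0" by (simp add: abs_if)
    have pow: "A (0, 0, \<bar>r\<bar> * int q) x0 = x0" for q
    proof (induction q)
      case (Suc q)
      then show ?case
        using mul[OF x0(1), of "(0, 0, \<bar>r\<bar>)" "(0, 0, \<bar>r\<bar> * int q)"] abs
        by (simp add: algebra_simps)
    qed (simp add: one x0)
    have "nat \<bar>r\<bar> dvd fact m"
      using r by (intro dvd_fact) auto
    then obtain q where "fact m = nat \<bar>r\<bar> * q" ..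
    then have "int (fact m) = \<bar>r\<bar> * int q"
      by (simp only: of_nat_mult) simp
    then show False using pow x0(2) by metis
  qed
  show ?thesis
  proof (rule ccontr)
    assume "\<not> ?thesis"
    then have neg: "\<not> inj_on (\<lambda>t. A t (A (int p, M * int p, 0) x0)) \<Sigma>" for p
      using closed x0(1) by blast
    have "\<forall>p. \<exists>s t. s \<in> \<Sigma> \<and> t \<in> \<Sigma> \<and> s \<noteq> t \<and>
        A s (A (int p, M * int p, 0) x0) = A t (A (int p, M * int p, 0) x0)"
      using neg unfolding inj_on_def by metis
    then obtain f g where fg: "\<And>p. f p \<in> \<Sigma> \<and> g p \<in> \<Sigma> \<and> f p \<noteq> g p \<and>
        A (f p) (A (int p, M * int p, 0) x0) = A (g p) (A (int p, M * int p, 0) x0)"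
      by metis
    \<comment> \<open>There are \<open>n + 1\<close> values of \<open>p\<close> but only
      \<open>n\<close> pairs, so one colliding pair serves two different values.\<close>
    have "(\<lambda>p. (f p, g p)) ` {0..n} \<subseteq> \<Sigma> \<times> \<Sigma>" using fg by auto
    then have "card ((\<lambda>p. (f p, g p)) ` {0..n}) \<le> n"
      unfolding n_def using fin by (intro card_mono) auto
    then have "\<not> inj_on (\<lambda>p. (f p, g p)) {0..n}"
      by (intro pigeonhole) simp
    then obtain p p' where p: "p \<le> n" "p' \<le> n" "p \<noteq> p'" "f p = f p'" "g p = g p'"
      by (auto simp: inj_on_def)
    obtain i j k where s: "f p = (i, j, k)" by (cases "f p")
    obtain i' j' k' where t: "g p = (i', j', k')" by (cases "g p")
    define u v where "u = i - i'" and "v = j - j'"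
    \<comment> \<open>\<open>(u, v, e P)\<close> is the quotient of the two colliding triples
      conjugated by \<open>(P, M * P, 0)\<close>; it fixes \<open>x0\<close> for
      \<open>P = p\<close> and \<open>P = p'\<close>.\<close>
    define e where "e P = k - k' + j' * u + P * (M * u - v)" for P :: int
    have stab: "A (u, v, e (int P)) x0 = x0" if "P = p \<or> P = p'" for P
    proof -
      define h where "h = (int P, M * int P, 0 :: int)"
      have "A (i, j, k) (A h x0) = A (i', j', k') (A h x0)"
        using fg[of P] that p s t by (auto simp: h_def)
      then have eq: "A (hmul (i, j, k) h) x0 = A (hmul (i', j', k') h) x0"
        by (simp add: mul x0)
      have "hmul (hinv (hmul (i', j', k') h)) (hmul (i, j, k) h) = (u, v, e (int P))"
        by (simp add: h_def u_def v_def e_def algebra_simps)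
      then have "A (u, v, e (int P)) x0
          = A (hinv (hmul (i', j', k') h)) (A (hmul (i, j, k) h) x0)"
        using mul x0(1) by metis
      also have "\<dots> = A (hmul (hinv (hmul (i', j', k') h)) (hmul (i', j', k') h)) x0"
        unfolding eq using mul x0(1) by metis
      finally show ?thesis using one x0(1) by (simp only: hmul_hinv)
    qed
    have bounds: "\<bar>i\<bar> \<le> B \<and> \<bar>j\<bar> \<le> B \<and> \<bar>k\<bar> \<le> B" "\<bar>i'\<bar> \<le> B \<and> \<bar>j'\<bar> \<le> B \<and> \<bar>k'\<bar> \<le> B"
      using B fg[of p] s t by auto
    show False
    proof (cases "u = 0 \<and> v = 0")
      case True
      then have "A (0, 0, k - k') x0 = x0" using stab[of p] by (simp add: e_def)
      then have "k = k' \<or> \<bar>k - k'\<bar> > int m" using central by fastforce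
      moreover have "k \<noteq> k'" using fg[of p] s t True by (auto simp: u_def v_def)
      moreover have "int m \<ge> 2 * B" using B0 by (simp add: m M_def)
      ultimately show False using bounds by auto
    next
      case False
      have uv: "\<bar>u\<bar> < M" "\<bar>v\<bar> < M" using bounds by (auto simp: u_def v_def M_def)
      have d0: "M * u - v \<noteq> 0"
      proof
        assume "M * u - v = 0"
        then have v: "v = M * u" by simp
        with False have "u \<noteq> 0" by auto
        then have "1 * M \<le> \<bar>u\<bar> * \<bar>M\<bar>" by (intro mult_mono) (use B0 in \<open>auto simp: M_def\<close>)
        also have "\<dots> = \<bar>v\<bar>" by (simp add: v abs_mult mult.commute)
        finally show False using uv by simp
      qed
      \<comment> \<open>Dividing one stabilizing triple by the other leaves a central one, whose
        exponent is nonzero and at most \<open>m\<close> in absolute value.\<close>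
      have "hmul (hinv (u, v, e (int p))) (u, v, e (int p')) = (0, 0, (int p' - int p) * (M * u - v))"
        by (simp add: e_def algebra_simps)
      then have "A (0, 0, (int p' - int p) * (M * u - v)) x0
          = A (hinv (u, v, e (int p))) (A (u, v, e (int p')) x0)"
        using mul x0(1) by metis
      also have "\<dots> = A (hinv (u, v, e (int p))) (A (u, v, e (int p)) x0)"
        by (metis stab)
      also have "\<dots> = x0" using mul x0(1) one hmul_hinv by metis
      finally have "\<bar>(int p' - int p) * (M * u - v)\<bar> > int m"
        using central p(3) d0 by fastforce
      moreover have "\<bar>int p' - int p\<bar> * \<bar>M * u - v\<bar> \<le> int n * (M * M + M)"
      proof (rule mult_mono)
        have "\<bar>M * u\<bar> \<le> M * M" unfolding abs_mult
          using uv B0 by (intro mult_mono) (auto simp: M_def)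
        then show "\<bar>M * u - v\<bar> \<le> M * M + M" using uv by linarith
      qed (use p B0 in auto)
      ultimately show False using B0 by (simp add: abs_mult m)
    qed
  qed
qed

section \<open>Commutators and Heisenberg pairs in a group\<close>

definition commutator :: "('a, 'm) monoid_scheme \<Rightarrow> 'a \<Rightarrow> 'a \<Rightarrow> 'a" where
  "commutator G x y = x \<otimes>\<^bsub>G\<^esub> y \<otimes>\<^bsub>G\<^esub> inv\<^bsub>G\<^esub> x \<otimes>\<^bsub>G\<^esub> inv\<^bsub>G\<^esub> y"

definition heis_map :: "('a, 'm) monoid_scheme \<Rightarrow> 'a \<Rightarrow> 'a \<Rightarrow> int_triple \<Rightarrow> 'a" where
  "heis_map G a b = (\<lambda>(i, j, k). a [^]\<^bsub>G\<^esub> i \<otimes>\<^bsub>G\<^esub> b [^]\<^bsub>G\<^esub> j \<otimes>\<^bsub>G\<^esub> commutator G a b [^]\<^bsub>G\<^esub> k)"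

text \<open>Elementwise form of a Heisenberg subgroup. As it consists of equations and inequations
  between elements, it passes from a subgroup to the whole group.\<close>

definition heis_pair :: "('a, 'm) monoid_scheme \<Rightarrow> 'a \<Rightarrow> 'a \<Rightarrow> bool" where
  "heis_pair G a b \<longleftrightarrow> a \<in> carrier G \<and> b \<in> carrier G \<and>
    commutator G a b \<otimes>\<^bsub>G\<^esub> a = a \<otimes>\<^bsub>G\<^esub> commutator G a b \<and>
    commutator G a b \<otimes>\<^bsub>G\<^esub> b = b \<otimes>\<^bsub>G\<^esub> commutator G a b \<and>
    (\<forall>n::nat. n > 0 \<longrightarrow> commutator G a b [^]\<^bsub>G\<^esub> n \<noteq> \<one>\<^bsub>G\<^esub>)"

context group begin

lemma mult_inv_cancel [simp]:
  assumes "x \<in> carrier G" "y \<in> carrier G"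
  shows "x \<otimes> (inv x \<otimes> y) = y" "inv x \<otimes> (x \<otimes> y) = y"
  using assms by (simp_all flip: m_assoc)

lemma commutator_closed [simp]:
  "x \<in> carrier G \<Longrightarrow> y \<in> carrier G \<Longrightarrow> commutator G x y \<in> carrier G"
  by (simp add: commutator_def)

lemma commutator_eq_one_iff:
  assumes "x \<in> carrier G" "y \<in> carrier G"
  shows "commutator G x y = \<one> \<longleftrightarrow> x \<otimes> y = y \<otimes> x"
proof -
  have "commutator G x y = x \<otimes> y \<otimes> inv (y \<otimes> x)"
    using assms by (simp add: commutator_def m_assoc inv_mult_group)
  then show ?thesis
    using assms inv_solve_right'[of "\<one>" "x \<otimes> y" "y \<otimes> x"] by simp
qed

lemma int_pow_conj:
  assumes "x \<in> carrier G" "y \<in> carrier G"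
  shows "(x \<otimes> y \<otimes> inv x) [^] (k::int) = x \<otimes> y [^] k \<otimes> inv x"
proof -
  have "(\<lambda>y. x \<otimes> y \<otimes> inv x) \<in> hom G G"
    using assms by (auto intro!: homI simp: m_assoc)
  from hom_int_pow[OF this assms(2) is_group is_group, of k] show ?thesis by simp
qed

lemma int_pow_commute:
  assumes "x \<otimes> y = y \<otimes> x" "x \<in> carrier G" "y \<in> carrier G"
  shows "x [^] (k::int) \<otimes> y = y \<otimes> x [^] k"
proof -
  have "y \<otimes> x \<otimes> inv y = x" using assms by (simp add: m_assoc flip: assms(1))
  then have "y \<otimes> x [^] k \<otimes> inv y = x [^] k" using int_pow_conj[of y x k] assms by simp
  then show ?thesis using assms by (metis inv_solve_right' int_pow_closed m_closed)
qed

text \<open>The only costly reordering moves powers of \<open>a\<close> left past powers of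
  \<open>b\<close>. Conjugation by \<open>a\<close> multiplies \<open>b\<close> by \<open>c\<close>;
  taking \<open>j\<close>-th powers shows how \<open>b [^] j\<close> conjugates \<open>a\<close>,
  and then taking \<open>i\<close>-th powers yields fact \<open>3\<close> with its correction
  exponent \<open>- (j * i)\<close>.\<close>

lemma heis_map_hmul:
  assumes carr: "a \<in> carrier G" "b \<in> carrier G"
    and ca: "commutator G a b \<otimes> a = a \<otimes> commutator G a b"
    and cb: "commutator G a b \<otimes> b = b \<otimes> commutator G a b"
  shows "heis_map G a b (hmul s t) = heis_map G a b s \<otimes> heis_map G a b t"
proof -
  define c where "c = commutator G a b"
  have [simp]: "a \<in> carrier G" "b \<in> carrier G" "c \<in> carrier G"
    using carr by (simp_all add: c_def)
  have cpow: "c [^] k \<otimes> a [^] i = a [^] i \<otimes> c [^] k" "c [^] k \<otimes> b [^] i = b [^] i \<otimes> c [^] k"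
    for i k :: int
    using int_pow_commute[OF int_pow_commute[OF ca, of k, symmetric], of i]
      int_pow_commute[OF int_pow_commute[OF cb, of k, symmetric], of i]
    by (simp_all add: c_def)
  have cpow_left: "c [^] k \<otimes> (b [^] i \<otimes> z) = b [^] i \<otimes> (c [^] k \<otimes> z)" if "z \<in> carrier G"
    for i k :: int and z
    using that cpow by (simp flip: m_assoc)
  have "a \<otimes> b \<otimes> inv a = c \<otimes> b"
    by (simp add: c_def commutator_def m_assoc)
  then have 1: "a \<otimes> b [^] j \<otimes> inv a = c [^] j \<otimes> b [^] j" for j :: int
    using int_pow_conj[of a b j] int_pow_mult_distrib[of c b j] cb by (simp add: c_def)
  have 2: "b [^] j \<otimes> a \<otimes> inv (b [^] j) = c [^] (- j) \<otimes> a" for j :: int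
  proof -
    have "a \<otimes> b [^] j = c [^] j \<otimes> b [^] j \<otimes> a"
      using 1[of j] by (metis carr \<open>c \<in> carrier G\<close> int_pow_closed inv_closed inv_solve_right' m_closed)
    then have "c [^] (- j) \<otimes> a \<otimes> b [^] j = b [^] j \<otimes> a"
      by (simp add: m_assoc int_pow_neg)
    then show ?thesis
      using inv_solve_right'[of "c [^] (- j) \<otimes> a" "b [^] j \<otimes> a" "b [^] j"] by simp
  qed
  have 3: "b [^] j \<otimes> a [^] i = a [^] i \<otimes> (b [^] j \<otimes> c [^] (- (j * i)))" for i j :: int
  proof -
    have "b [^] j \<otimes> a [^] i \<otimes> inv (b [^] j) = (c [^] (- j) \<otimes> a) [^] i"
      using int_pow_conj[of "b [^] j" a i] 2 by simp
    also have "\<dots> = c [^] (- j * i) \<otimes> a [^] i"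
      using int_pow_mult_distrib[of "c [^] (- j)" a i] cpow[of "- j" 1] int_pow_pow[of c "- j" i] by simp
    also have "\<dots> = a [^] i \<otimes> c [^] (- (j * i))" by (simp add: cpow)
    finally have "b [^] j \<otimes> a [^] i = a [^] i \<otimes> c [^] (- (j * i)) \<otimes> b [^] j"
      by (simp add: inv_solve_right')
    then show ?thesis by (simp add: m_assoc cpow)
  qed
  obtain i j k i' j' k' where st: "s = (i, j, k)" "t = (i', j', k')" by (metis prod_cases3)
  have "heis_map G a b s \<otimes> heis_map G a b t
      = a [^] i \<otimes> (b [^] j \<otimes> (c [^] k \<otimes> a [^] i') \<otimes> b [^] j') \<otimes> c [^] k'"
    by (simp add: st heis_map_def m_assoc flip: c_def)
  also have "\<dots> = a [^] i \<otimes> (b [^] j \<otimes> a [^] i') \<otimes> (c [^] k \<otimes> b [^] j') \<otimes> c [^] k'"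
    by (simp add: cpow m_assoc)
  also have "\<dots> = a [^] i \<otimes> a [^] i' \<otimes> (b [^] j \<otimes> (c [^] (- (j * i')) \<otimes> b [^] j') \<otimes> c [^] k) \<otimes> c [^] k'"
    unfolding 3 by (simp add: cpow cpow_left m_assoc)
  also have "\<dots> = (a [^] i \<otimes> a [^] i') \<otimes> (b [^] j \<otimes> b [^] j') \<otimes> (c [^] (- (j * i')) \<otimes> (c [^] k \<otimes> c [^] k'))"
    by (simp add: m_assoc cpow_left)
  also have "\<dots> = heis_map G a b (hmul s t)"
    by (simp add: st heis_map_def int_pow_mult algebra_simps flip: c_def)
      (simp add: algebra_simps flip: int_pow_mult)
  finally show ?thesis by simp
qed

lemma heis_map_closed [simp]:
  "a \<in> carrier G \<Longrightarrow> b \<in> carrier G \<Longrightarrow> heis_map G a b t \<in> carrier G"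
  by (cases t) (simp add: heis_map_def)

text \<open>Pulls the action back along \<open>heis_map\<close>. As the commutator has infinite
  order, faithfulness makes each of its positive powers move some point. Non-foldability and growth
  both rest on this statement.\<close>

lemma heis_pair_injective_point:
  assumes pair: "heis_pair G a b" and act: "faithful_G_set G X \<phi>" and fin: "finite \<Sigma>"
  shows "\<exists>x\<in>X. inj_on (\<lambda>t. \<phi> (heis_map G a b t) x) \<Sigma>"
proof -
  interpret faithful_action G X \<phi> using act by (simp add: faithful_G_set_def)
  have carr: "a \<in> carrier G" "b \<in> carrier G" using pair by (simp_all add: heis_pair_def)
  show ?thesis
  proof (rule heisenberg_action_injective_point[where A = "\<lambda>t. \<phi> (heis_map G a b t)", OF _ _ _ _ fin])
    fix x t assume "x \<in> X"
    then show "\<phi> (heis_map G a b t) x \<in> X"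
      using element_image[OF heis_map_closed[OF carr]] by blast
  next
    fix x assume "x \<in> X"
    then show "\<phi> (heis_map G a b (0, 0, 0)) x = x"
      using carr id_eq_one by (simp add: heis_map_def) (metis restrict_apply')
  next
    fix s t x assume "x \<in> X"
    then show "\<phi> (heis_map G a b (hmul s t)) x = \<phi> (heis_map G a b s) (\<phi> (heis_map G a b t) x)"
      using pair heis_map_hmul[of a b s t] composition_rule carr by (simp add: heis_pair_def)
  next
    fix N :: nat assume "N > 0"
    then have "commutator G a b [^] N \<noteq> \<one>" using pair by (simp add: heis_pair_def)
    then show "\<exists>x\<in>X. \<phi> (heis_map G a b (0, 0, int N)) x \<noteq> x"
      using act carr by (auto simp: faithful_G_set_def faithful_action_iff heis_map_def int_pow_int)
  qed
qed

end

section \<open>The presented Heisenberg group\<close>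

definition heis_rel :: "(heis_gen word \<times> heis_gen word) set" where
  "heis_rel = {(word_comm (gen GenA) (gen GenB), gen GenC),
     (word_comm (gen GenA) (gen GenC), []),
     (word_comm (gen GenB) (gen GenC), [])}"

lemma heisenberg_group_eq: "heisenberg_group = presented_group heis_rel"
  by (simp add: heisenberg_group_def heis_rel_def)

fun heis_gen_triple :: "heis_gen \<Rightarrow> int_triple" where
  "heis_gen_triple GenA = (1, 0, 0)"
| "heis_gen_triple GenB = (0, 1, 0)"
| "heis_gen_triple GenC = (0, 0, 1)"

definition letter_triple :: "heis_gen \<times> bool \<Rightarrow> int_triple" where
  "letter_triple l = (if snd l then heis_gen_triple (fst l) else hinv (heis_gen_triple (fst l)))"

definition word_triple :: "heis_gen word \<Rightarrow> int_triple" where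
  "word_triple w = foldr (\<lambda>l. hmul (letter_triple l)) w (0, 0, 0)"

lemma hmul_assoc: "hmul (hmul s t) u = hmul s (hmul t u)"
  by (cases s; cases t; cases u) (simp add: algebra_simps)

lemma hmul_zero [simp]: "hmul (0, 0, 0) t = t" "hmul t (0, 0, 0) = t"
  by (cases t; simp)+

lemma word_triple_append: "word_triple (u @ v) = hmul (word_triple u) (word_triple v)"
  by (induction u) (simp_all add: word_triple_def hmul_assoc)

text \<open>The generating triples satisfy the three relations, so the triple of a word depends only
  on its class. This invariant shows that \<open>GenC\<close> has infinite order in the presented
  group.\<close>

lemma pres_eq_word_triple: "pres_eq heis_rel u v \<Longrightarrow> word_triple u = word_triple v"
proof (induction rule: pres_eq.induct)
  case (pres_rel u v)
  then show ?case
    by (auto simp: heis_rel_def word_comm_def gen_def word_inv_def word_triple_def letter_triple_def)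
next
  case (pres_cancel x b)
  show ?case by (cases x; cases b) (simp_all add: word_triple_def letter_triple_def)
qed (simp_all add: word_triple_append)

text \<open>The images of \<open>GenA\<close> and \<open>GenB\<close> form the pair: the relations
  make their commutator commute with both, and \<open>word_triple\<close> shows that it has infinite
  order.\<close>

lemma heisenberg_subgroup_pair:
  fixes G (structure)
  assumes "group G" and H: "subgroup H G" and iso: "G\<lparr>carrier := H\<rparr> \<cong> heisenberg_group"
  obtains a b where "heis_pair G a b" "H = range (heis_map G a b)"
proof -
  interpret group G by fact
  interpret P: group heisenberg_group by (simp add: heisenberg_group_eq group_presented_group)
  interpret GH: group "G\<lparr>carrier := H\<rparr>" using H by (rule subgroup_imp_group)
  obtain \<psi> where \<psi>: "\<psi> \<in> iso heisenberg_group (G\<lparr>carrier := H\<rparr>)"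
    using GH.iso_sym[OF iso] by (auto simp: is_iso_def)
  define f where "f w = \<psi> (pres_class heis_rel w)" for w
  have carrP: "carrier heisenberg_group = range (pres_class heis_rel)"
    by (simp add: heisenberg_group_eq presented_group_def)
  have bij: "bij_betw \<psi> (range (pres_class heis_rel)) H"
    using \<psi> by (simp add: iso_def carrP)
  have f_app: "f (u @ v) = f u \<otimes> f v" for u v
  proof -
    have "\<psi> (pres_class heis_rel u \<otimes>\<^bsub>heisenberg_group\<^esub> pres_class heis_rel v) = f u \<otimes> f v"
      using \<psi> by (simp add: iso_def hom_def f_def carrP)
    then show ?thesis by (simp add: f_def heisenberg_group_eq presented_group_mult)
  qed
  have f_eq: "f u = f v \<longleftrightarrow> pres_eq heis_rel u v" for u v
    using bij by (auto simp: f_def bij_betw_def inj_on_eq_iff simp flip: pres_class_eq_iff)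
  have range_f: "range f = H"
    using bij by (auto simp: f_def bij_betw_def image_image)
  have Hcarr: "H \<subseteq> carrier G" using H by (rule subgroup.subset)
  have f_carr [simp]: "f u \<in> carrier G" for u using range_f Hcarr by auto
  have f_Nil: "f [] = \<one>"
    using f_app[of "[]" "[]"] by (metis f_carr l_cancel_one' append_Nil)
  have f_neg: "f [(x, \<not> b)] = inv (f [(x, b)])" for x b
    using f_app[of "[(x, \<not> b)]" "[(x, b)]"] pres_cancel[of heis_rel x "\<not> b"]
    by (intro inv_equality[symmetric]) (auto simp: f_Nil simp flip: f_eq)
  define a b c where "a = f (gen GenA)" and "b = f (gen GenB)" and "c = f (gen GenC)"
  have carr: "a \<in> carrier G" "b \<in> carrier G" "c \<in> carrier G" by (simp_all add: a_def b_def c_def)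
  have f_comm: "f (word_comm (gen x) (gen y)) = commutator G (f (gen x)) (f (gen y))" for x y
  proof -
    have "f (word_inv (gen x)) = inv (f (gen x))" for x
      using f_neg[of x True] by (simp add: word_inv_def gen_def)
    then show ?thesis by (simp add: word_comm_def f_app commutator_def m_assoc)
  qed
  have rel: "f u = f v" if "(u, v) \<in> heis_rel" for u v
    using that by (simp add: f_eq pres_rel)
  have c: "commutator G a b = c"
    unfolding a_def b_def c_def f_comm[symmetric] by (rule rel) (simp add: heis_rel_def)
  have "commutator G a c = \<one>" "commutator G b c = \<one>"
    unfolding a_def b_def c_def f_comm[symmetric] f_Nil[symmetric]
    by (rule rel, simp add: heis_rel_def)+
  then have comm: "c \<otimes> a = a \<otimes> c" "c \<otimes> b = b \<otimes> c"
    using carr commutator_eq_one_iff by metis+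
  have fpow: "f (concat (replicate n (gen GenC))) = c [^] n" for n :: nat
    by (induction n) (simp_all add: f_Nil f_app nat_pow_comm[of c _ 1, simplified] carr flip: c_def)
  have triple_pow: "word_triple (concat (replicate n (gen GenC))) = (0, 0, int n)" for n
    by (induction n) (simp_all add: word_triple_append, simp_all add: word_triple_def gen_def letter_triple_def)
  have "c [^] n \<noteq> \<one>" if "n > 0" for n :: nat
  proof
    assume "c [^] n = \<one>"
    then have "pres_eq heis_rel (concat (replicate n (gen GenC))) []"
      by (simp add: fpow f_Nil flip: f_eq)
    then show False using pres_eq_word_triple triple_pow[of n] that by (fastforce simp: word_triple_def)
  qed
  then have pair: "heis_pair G a b" using carr comm by (simp add: heis_pair_def c)
  \<comment> \<open>Every element of \<open>H\<close> has the normal form that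
    \<open>heis_map\<close> attaches to the triple of a word representing it; hence
    \<open>heis_map\<close> reaches all of \<open>H\<close>.\<close>
  have mu: "f w = heis_map G a b (word_triple w)" for w
  proof (induction w)
    case Nil
    show ?case using carr by (simp add: f_Nil word_triple_def heis_map_def c)
  next
    case (Cons l w)
    have *: "f [(GenA, True)] = a" "f [(GenB, True)] = b" "f [(GenC, True)] = c"
      by (simp_all add: a_def b_def c_def gen_def)
    have "f [l] = heis_map G a b (letter_triple l)"
    proof (cases l)
      case (Pair x s)
      then show ?thesis using carr f_neg[of x True]
        by (cases x; cases s) (simp_all add: letter_triple_def heis_map_def c int_pow_neg *)
    qed
    then show ?case
      using f_app[of "[l]" w] Cons carr comm heis_map_hmul[of a b]
      by (simp add: word_triple_def c)
  qed
  have "heis_map G a b t \<in> H" for t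
  proof (cases t)
    case (fields i j k)
    have "a \<in> H" "b \<in> H" "c \<in> H" using range_f by (auto simp: a_def b_def c_def)
    then show ?thesis
      by (simp add: fields heis_map_def c subgroup_int_pow_closed[OF H] subgroup.m_closed[OF H])
  qed
  then have "H = range (heis_map G a b)"
    using range_f mu by blast
  with pair show ?thesis by (rule that)
qed

lemma non_foldable_heisenberg:
  fixes G (structure)
  assumes "group G" "subgroup H G" "G\<lparr>carrier := H\<rparr> \<cong> heisenberg_group"
  shows "non_foldable TYPE('x) G H"
  unfolding non_foldable_def
proof (intro conjI allI impI)
  interpret group G by fact
  show "H \<subseteq> carrier G" using assms(2) by (rule subgroup.subset)
  fix X :: "'x set" and \<phi> \<Sigma>
  assume act: "faithful_G_set G X \<phi>" and \<Sigma>: "finite \<Sigma>" "\<Sigma> \<subseteq> H"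
  obtain a b where ab: "heis_pair G a b" "H = range (heis_map G a b)"
    using heisenberg_subgroup_pair[OF assms] .
  obtain T where T: "finite T" "\<Sigma> = heis_map G a b ` T"
    using finite_subset_image \<Sigma> unfolding ab(2) by metis
  obtain x where "x \<in> X" "inj_on (\<lambda>t. \<phi> (heis_map G a b t) x) T"
    using heis_pair_injective_point[OF ab(1) act T(1)] by blast
  then show "\<exists>x\<in>X. inj_on (\<lambda>g. \<phi> g x) \<Sigma>"
    unfolding T(2) by (auto intro!: bexI[of _ x] inj_on_imageI simp: comp_def)
qed

section \<open>Growth of faithful actions\<close>

text \<open>Unlike \<open>word_length\<close>, a minimum that is meaningful only once some word
  exists, this bound needs just one witness and adds up under products.\<close>

definition word_within :: "('a, 'm) monoid_scheme \<Rightarrow> 'a set \<Rightarrow> nat \<Rightarrow> 'a \<Rightarrow> bool" where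
  "word_within G S N g \<longleftrightarrow>
    (\<exists>ws. set ws \<subseteq> S \<and> length ws \<le> N \<and> foldr (\<otimes>\<^bsub>G\<^esub>) ws \<one>\<^bsub>G\<^esub> = g)"

lemma word_within_mono: "word_within G S M g \<Longrightarrow> M \<le> N \<Longrightarrow> word_within G S N g"
  unfolding word_within_def by (metis le_trans)

lemma word_length_le: "word_within G S N g \<Longrightarrow> word_length G S g \<le> N"
  unfolding word_within_def word_length_def by (metis (mono_tags, lifting) Least_le le_trans)

context group begin

lemma foldr_closed: "set ws \<subseteq> carrier G \<Longrightarrow> foldr (\<otimes>) ws \<one> \<in> carrier G"
  by (induction ws) auto

lemma word_within_mult:
  assumes S: "S \<subseteq> carrier G" and "word_within G S M g" "word_within G S N h"
  shows "word_within G S (M + N) (g \<otimes> h)"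
proof -
  obtain u v where u: "set u \<subseteq> S" "length u \<le> M" "foldr (\<otimes>) u \<one> = g"
    and v: "set v \<subseteq> S" "length v \<le> N" "foldr (\<otimes>) v \<one> = h"
    using assms(2,3) unfolding word_within_def by blast
  have "foldr (\<otimes>) (u @ v) \<one> = foldr (\<otimes>) u \<one> \<otimes> foldr (\<otimes>) v \<one>" if "set u \<subseteq> carrier G" for u
    using that S v(1) by (induction u) (simp_all add: m_assoc foldr_closed)
  then show ?thesis
    unfolding word_within_def using u v S by (intro exI[of _ "u @ v"]) auto
qed

lemma word_within_pow:
  assumes "S \<subseteq> carrier G" "word_within G S M g"
  shows "word_within G S (n * M) (g [^] (n::nat))"
proof (induction n)
  case 0
  show ?case unfolding word_within_def by (intro exI[of _ "[]"]) simp
next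
  case (Suc n)
  then show ?case using word_within_mult[OF assms(1) Suc assms(2)] by (simp add: add.commute)
qed

text \<open>Symmetry of \<open>S\<close> absorbs the inverses occurring in \<open>generate\<close>,
  so words over \<open>S\<close> itself suffice.\<close>

lemma word_within_exists:
  assumes S: "finite_symmetric_generating_set G S" and "g \<in> carrier G"
  shows "\<exists>N. word_within G S N g"
proof -
  have Sc: "S \<subseteq> carrier G" using S by (simp add: finite_symmetric_generating_set_def)
  have letter: "word_within G S 1 s" if "s \<in> S" for s
    unfolding word_within_def using that Sc by (intro exI[of _ "[s]"]) auto
  have "g \<in> generate G S" using assms by (simp add: finite_symmetric_generating_set_def)
  then show ?thesis
  proof induction
    case one
    show ?case unfolding word_within_def by (intro exI[of _ "[]"] exI) auto
  next
    case (incl h)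
    then show ?case using letter by blast
  next
    case (inv h)
    then show ?case using letter S unfolding finite_symmetric_generating_set_def by blast
  next
    case (eng h1 h2)
    then show ?case using word_within_mult[OF Sc] by blast
  qed
qed

text \<open>Some word exists for each element, so the minimum in \<open>word_length\<close> is
  attained and the ball consists of products of the finitely many words of length at most
  \<open>n\<close>.\<close>

lemma finite_word_ball:
  assumes S: "finite_symmetric_generating_set G S"
  shows "finite (word_ball G S n)"
proof -
  have "word_ball G S n \<subseteq> (\<lambda>ws. foldr (\<otimes>) ws \<one>) ` {ws. set ws \<subseteq> S \<and> length ws \<le> n}"
  proof
    fix g assume g: "g \<in> word_ball G S n"
    then obtain ws where "set ws \<subseteq> S" "foldr (\<otimes>) ws \<one> = g"
      using word_within_exists[OF S, of g] unfolding word_ball_def word_within_def by auto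
    then have "\<exists>N ws. set ws \<subseteq> S \<and> length ws = N \<and> foldr (\<otimes>) ws \<one> = g" by blast
    from LeastI_ex[OF this] obtain ws where
      "set ws \<subseteq> S" "length ws = word_length G S g" "foldr (\<otimes>) ws \<one> = g"
      unfolding word_length_def by blast
    then show "g \<in> (\<lambda>ws. foldr (\<otimes>) ws \<one>) ` {ws. set ws \<subseteq> S \<and> length ws \<le> n}"
      using g by (force simp: word_ball_def)
  qed
  moreover have "finite S" using S by (simp add: finite_symmetric_generating_set_def)
  ultimately show ?thesis using finite_lists_length_le finite_subset by blast
qed

text \<open>The cardinalities are bounded by that of the ball, so \<open>Max\<close> ranges over a
  finite set even for infinite \<open>X\<close>.\<close>

lemma card_orbit_le_action_growth:
  assumes S: "finite_symmetric_generating_set G S" and "x \<in> X"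
  shows "card ((\<lambda>g. \<phi> g x) ` word_ball G S n) \<le> action_growth G S X \<phi> n"
  unfolding action_growth_def
proof (rule Max_ge)
  have "(\<lambda>x. card ((\<lambda>g. \<phi> g x) ` word_ball G S n)) ` X \<subseteq> {..card (word_ball G S n)}"
    using card_image_le[OF finite_word_ball[OF S]] by auto
  then show "finite ((\<lambda>x. card ((\<lambda>g. \<phi> g x) ` word_ball G S n)) ` X)"
    by (rule finite_subset) simp
qed (use assms in simp)

text \<open>\<open>c\<^bsup>qn\<^esup> = [a\<^bsup>n\<^esup>, b\<^bsup>q\<^esup>]\<close>, so powers of \<open>c\<close> up to \<open>n\<^sup>2\<close> have word length linear in \<open>n\<close>.\<close>

lemma heis_pair_commutator_form:
  assumes pair: "heis_pair G a b" and c: "c = commutator G a b"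
  shows "heis_map G a b (int i, int j, int (q * n + r)) =
    a [^] i \<otimes> b [^] j \<otimes> c [^] r \<otimes> a [^] n \<otimes> b [^] q \<otimes> inv a [^] n \<otimes> inv b [^] q"
proof -
  have carr [simp]: "a \<in> carrier G" "b \<in> carrier G" using pair by (simp_all add: heis_pair_def)
  have [simp]: "heis_map G a b (k, 0, 0) = a [^] k" "heis_map G a b (0, k, 0) = b [^] k"
    "heis_map G a b (0, 0, k) = c [^] k" for k
    by (simp_all add: heis_map_def c)
  have hom: "heis_map G a b (hmul s t) = heis_map G a b s \<otimes> heis_map G a b t" for s t
    using pair heis_map_hmul unfolding heis_pair_def by blast
  have "(int i, int j, int (q * n + r)) = hmul (hmul (hmul (hmul (hmul (hmul (int i, 0, 0) (0, int j, 0))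
      (0, 0, int r)) (int n, 0, 0)) (0, int q, 0)) (- int n, 0, 0)) (0, - int q, 0)"
    by (simp add: algebra_simps)
  then have "heis_map G a b (int i, int j, int (q * n + r)) =
    a [^] int i \<otimes> b [^] int j \<otimes> c [^] int r \<otimes> a [^] int n \<otimes> b [^] int q
      \<otimes> a [^] (- int n) \<otimes> b [^] (- int q)"
    by (simp only: hom) simp
  then show ?thesis by (simp add: int_pow_int int_pow_neg_int nat_pow_inv)
qed

text \<open>Writing \<open>k = q * n + r\<close> with \<open>q\<close> and \<open>r\<close> at most
  \<open>n\<close> gives seven factors, each a power with exponent at most \<open>n\<close> of one
  of five fixed elements.\<close>

lemma heis_map_in_word_ball:
  assumes pair: "heis_pair G a b" and S: "finite_symmetric_generating_set G S"
  shows "\<exists>C>0. \<forall>n i j k. i < n \<longrightarrow> j < n \<longrightarrow> k < n ^ 2 \<longrightarrow>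
    heis_map G a b (int i, int j, int k) \<in> word_ball G S (C * n)"
proof -
  define c where "c = commutator G a b"
  have carr: "a \<in> carrier G" "b \<in> carrier G" using pair by (simp_all add: heis_pair_def)
  have Sc: "S \<subseteq> carrier G" using S by (simp add: finite_symmetric_generating_set_def)
  have "\<exists>N. word_within G S N g" if "g \<in> {a, b, c, inv a, inv b}" for g
    using word_within_exists[OF S, of g] that carr by (auto simp: c_def)
  then obtain N where N: "\<And>g. g \<in> {a, b, c, inv a, inv b} \<Longrightarrow> word_within G S (N g) g"
    by metis
  define L where "L = Suc (Max (N ` {a, b, c, inv a, inv b}))"
  have L: "word_within G S L g" if "g \<in> {a, b, c, inv a, inv b}" for g
  proof (rule word_within_mono[OF N[OF that]])
    show "N g \<le> L" unfolding L_def using that by (intro le_SucI Max_ge) auto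
  qed
  have "heis_map G a b (int i, int j, int k) \<in> word_ball G S (7 * L * n)"
    if ijk: "i < n" "j < n" "k < n ^ 2" for i j k n
  proof -
    define q r where "q = k div n" and "r = k mod n"
    have k: "k = q * n + r" by (simp add: q_def r_def)
    have qr: "q \<le> n" "r \<le> n"
      using ijk by (auto simp: q_def r_def power2_eq_square less_mult_imp_div_less less_imp_le)
    have pow: "word_within G S (n * L) (g [^] p)" if "g \<in> {a, b, c, inv a, inv b}" "p \<le> n" for g p
      using word_within_mono[OF word_within_pow[OF Sc L[OF that(1)]]] that(2) by simp
    have "word_within G S (n * L + n * L + n * L + n * L + n * L + n * L + n * L)
        (a [^] i \<otimes> b [^] j \<otimes> c [^] r \<otimes> a [^] n \<otimes> b [^] q \<otimes> inv a [^] n \<otimes> inv b [^] q)"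
      by (intro word_within_mult[OF Sc] pow) (use ijk qr in auto)
    then have "word_length G S (heis_map G a b (int i, int j, int k)) \<le> 7 * L * n"
      using heis_pair_commutator_form[OF pair c_def, of i j q n r] word_length_le
      by (fastforce simp: k algebra_simps)
    then show ?thesis using carr by (simp add: word_ball_def)
  qed
  moreover have "7 * L > 0" by (simp add: L_def)
  ultimately show ?thesis by blast
qed

lemma growth_of_heis_pair:
  assumes pair: "heis_pair G a b" and S: "finite_symmetric_generating_set G S"
    and act: "faithful_G_set G X \<phi>"
  shows "growth_le (\<lambda>n. real n ^ 4) (\<lambda>n. real (action_growth G S X \<phi> n))"
proof -
  obtain C where C: "C > 0" "\<And>n i j k. i < n \<Longrightarrow> j < n \<Longrightarrow> k < n ^ 2 \<Longrightarrow>
      heis_map G a b (int i, int j, int k) \<in> word_ball G S (C * n)"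
    using heis_map_in_word_ball[OF pair S] by blast
  have le: "n ^ 4 \<le> action_growth G S X \<phi> (C * n)" for n
  proof -
    define \<Sigma> where "\<Sigma> = (\<lambda>(i, j, k). (int i, int j, int k)) ` ({..<n} \<times> {..<n} \<times> {..<n ^ 2})"
    have "card \<Sigma> = card ({..<n} \<times> {..<n} \<times> {..<n ^ 2})"
      unfolding \<Sigma>_def by (intro card_image) (auto simp: inj_on_def)
    then have card: "card \<Sigma> = n ^ 4"
      by (simp add: card_cartesian_product power2_eq_square power4_eq_xxxx)
    have fin: "finite \<Sigma>" by (simp add: \<Sigma>_def)
    obtain x where x: "x \<in> X" "inj_on (\<lambda>t. \<phi> (heis_map G a b t) x) \<Sigma>"
      using heis_pair_injective_point[OF pair act fin] by blast
    have "(\<lambda>t. \<phi> (heis_map G a b t) x) ` \<Sigma> \<subseteq> (\<lambda>g. \<phi> g x) ` word_ball G S (C * n)"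
      using C(2) by (auto simp: \<Sigma>_def)
    then have "card ((\<lambda>t. \<phi> (heis_map G a b t) x) ` \<Sigma>) \<le> card ((\<lambda>g. \<phi> g x) ` word_ball G S (C * n))"
      by (intro card_mono finite_imageI finite_word_ball[OF S])
    then show ?thesis
      using card_orbit_le_action_growth[OF S x(1), of \<phi> "C * n"] card_image[OF x(2)] card by simp
  qed
  have "real n ^ 4 \<le> real C * real (action_growth G S X \<phi> (C * n))" for n
  proof -
    have "n ^ 4 \<le> C * action_growth G S X \<phi> (C * n)"
      using le[of n] C(1) by (metis le_trans mult_le_mono1 nat_mult_1 Suc_leI One_nat_def)
    then show ?thesis by (metis of_nat_le_iff of_nat_mult of_nat_power)
  qed
  then show ?thesis unfolding growth_le_def using C(1) by auto
qed

end

section \<open>Finitely generated nilpotent groups\<close>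

declare lower_central_series.simps(2) [simp del]

section \<open>Commutator calculus and the lower central series\<close>

context group begin

lemma commutator_one [simp]: "x \<in> carrier G \<Longrightarrow> commutator G x \<one> = \<one>" "x \<in> carrier G \<Longrightarrow> commutator G \<one> x = \<one>"
  by (simp_all add: commutator_def)

lemma commutator_mult_right:
  assumes "x \<in> carrier G" "y \<in> carrier G" "z \<in> carrier G"
  shows "commutator G x (y \<otimes> z) = commutator G x y \<otimes> (y \<otimes> commutator G x z \<otimes> inv y)"
  using assms by (simp add: commutator_def m_assoc inv_mult_group)

lemma commutator_mult_left:
  assumes "x \<in> carrier G" "y \<in> carrier G" "z \<in> carrier G"
  shows "commutator G (x \<otimes> y) z = (x \<otimes> commutator G y z \<otimes> inv x) \<otimes> commutator G x z"
  using assms by (simp add: commutator_def m_assoc inv_mult_group)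

lemma commutator_inv_right:
  assumes "x \<in> carrier G" "y \<in> carrier G"
  shows "commutator G x (inv y) = inv y \<otimes> inv (commutator G x y) \<otimes> inv (inv y)"
  using assms by (simp add: commutator_def m_assoc inv_mult_group)

lemma commutator_inv_left:
  assumes "x \<in> carrier G" "y \<in> carrier G"
  shows "commutator G (inv x) y = inv x \<otimes> inv (commutator G x y) \<otimes> inv (inv x)"
  using assms by (simp add: commutator_def m_assoc inv_mult_group)

text \<open>Turns closure under commutators into closure under conjugation.\<close>

lemma conj_eq_commutator:
  assumes "x \<in> carrier G" "y \<in> carrier G"
  shows "y \<otimes> x \<otimes> inv y = inv (commutator G x y) \<otimes> x"
  using assms by (simp add: commutator_def m_assoc inv_mult_group)

lemma commutator_consistent:
  assumes "subgroup K G" "x \<in> K" "y \<in> K"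
  shows "commutator (G\<lparr>carrier := K\<rparr>) x y = commutator G x y"
  using assms by (simp add: commutator_def)

lemma lower_central_series_Suc:
  "lower_central_series G (Suc i) =
    generate G {commutator G x y | x y. x \<in> lower_central_series G i \<and> y \<in> carrier G}"
  by (simp add: lower_central_series.simps(2) commutator_def)

lemma subgroup_lower_central_series: "subgroup (lower_central_series G i) G"
proof (induction i)
  case 0
  show ?case using subgroup_self by simp
next
  case (Suc i)
  show ?case unfolding lower_central_series_Suc
    using subgroup.mem_carrier[OF Suc] by (intro generate_is_subgroup) auto
qed

lemma commutator_in_lower_central_series:
  "x \<in> lower_central_series G i \<Longrightarrow> y \<in> carrier G \<Longrightarrow> commutator G x y \<in> lower_central_series G (Suc i)"
  unfolding lower_central_series_Suc by (rule generate.incl) blast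

text \<open>Normality of the term is a hypothesis because its proof by induction uses this inclusion
  for the preceding term. Given it, \<open>commutator G x y\<close> is \<open>x\<close> times a
  conjugate of \<open>inv x\<close>.\<close>

lemma lower_central_series_Suc_subset_if_conj:
  assumes conj: "\<And>x y. x \<in> lower_central_series G i \<Longrightarrow> y \<in> carrier G \<Longrightarrow>
    y \<otimes> x \<otimes> inv y \<in> lower_central_series G i"
  shows "lower_central_series G (Suc i) \<subseteq> lower_central_series G i"
  unfolding lower_central_series_Suc
proof (rule generate_subgroup_incl[OF _ subgroup_lower_central_series], safe)
  note sub = subgroup_lower_central_series[of i]
  fix x y assume x: "x \<in> lower_central_series G i" "y \<in> carrier G"
  have "x \<in> carrier G" using sub x(1) by (rule subgroup.mem_carrier)
  then have "commutator G x y = x \<otimes> (y \<otimes> inv x \<otimes> inv y)"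
    using x by (simp add: commutator_def m_assoc)
  then show "commutator G x y \<in> lower_central_series G i"
    using conj x sub by (metis subgroup.m_closed subgroup.m_inv_closed)
qed

lemma lower_central_series_conj:
  assumes "x \<in> lower_central_series G i" "y \<in> carrier G"
  shows "y \<otimes> x \<otimes> inv y \<in> lower_central_series G i"
  using assms
proof (induction i arbitrary: x y)
  case (Suc i)
  note sub = subgroup_lower_central_series[of "Suc i"]
  have "commutator G x y \<in> lower_central_series G (Suc i)"
    using Suc.prems lower_central_series_Suc_subset_if_conj[OF Suc.IH]
    by (blast intro: commutator_in_lower_central_series)
  then show ?case
    using Suc.prems sub conj_eq_commutator subgroup.mem_carrier[OF sub]
    by (metis subgroup.m_closed subgroup.m_inv_closed)
qed simp

lemma lower_central_series_Suc_subset: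
  "lower_central_series G (Suc i) \<subseteq> lower_central_series G i"
  by (rule lower_central_series_Suc_subset_if_conj[OF lower_central_series_conj])

lemma lower_central_series_subgroup_mono:
  assumes K: "subgroup K G"
  shows "lower_central_series (G\<lparr>carrier := K\<rparr>) i \<subseteq> lower_central_series G i"
proof (induction i)
  case 0
  show ?case using subgroup.subset[OF K] by simp
next
  case (Suc i)
  interpret K: group "G\<lparr>carrier := K\<rparr>" using K by (rule subgroup_imp_group)
  have sub: "lower_central_series (G\<lparr>carrier := K\<rparr>) i \<subseteq> K"
    using subgroup.subset[OF K.subgroup_lower_central_series] by simp
  let ?C = "{commutator G x y | x y. x \<in> lower_central_series (G\<lparr>carrier := K\<rparr>) i \<and> y \<in> K}"
  have CK: "?C \<subseteq> K"
    using sub K by (auto simp: commutator_def subgroup.m_closed subgroup.m_inv_closed)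
  have eq: "commutator (G\<lparr>carrier := K\<rparr>) x y = commutator G x y"
    if "x \<in> lower_central_series (G\<lparr>carrier := K\<rparr>) i" "y \<in> K" for x y
    using commutator_consistent[OF K] sub that by blast
  have "lower_central_series (G\<lparr>carrier := K\<rparr>) (Suc i) = generate (G\<lparr>carrier := K\<rparr>) ?C"
    unfolding K.lower_central_series_Suc
    by (intro arg_cong[where f = "generate _"] Collect_cong ex_cong1) (auto simp: eq)
  also have "\<dots> = generate G ?C" by (rule generate_consistent[OF CK K])
  also have "\<dots> \<subseteq> lower_central_series G (Suc i)"
    unfolding lower_central_series_Suc
    using Suc subgroup.subset[OF K] by (intro mono_generate) blast
  finally show ?case .
qed

text \<open>Expresses without quotients that each factor of the series is finitely generated:
  commutators of generators of one factor with elements of \<open>S\<close> generate the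
  next.\<close>

lemma lower_central_series_finite_generation:
  assumes S: "finite S" "S \<subseteq> carrier G" "generate G S = carrier G"
  shows "\<exists>F. finite F \<and> F \<subseteq> lower_central_series G i \<and>
    lower_central_series G i \<subseteq> generate G (F \<union> lower_central_series G (Suc i))"
proof (induction i)
  case 0
  show ?case using S mono_generate[of S "S \<union> lower_central_series G (Suc 0)"]
    by (intro exI[of _ S]) auto
next
  case (Suc i)
  then obtain F where F: "finite F" "F \<subseteq> lower_central_series G i"
    "lower_central_series G i \<subseteq> generate G (F \<union> lower_central_series G (Suc i))" by blast
  define F' where "F' = (\<lambda>(x, s). commutator G x s) ` (F \<times> S)"
  define P where "P = generate G (F' \<union> lower_central_series G (Suc (Suc i)))"
  note sub = subgroup_lower_central_series
  have F': "F' \<subseteq> lower_central_series G (Suc i)"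
    unfolding F'_def using F(2) S(2) by (auto intro!: commutator_in_lower_central_series)
  have Fcarr: "F \<union> lower_central_series G (Suc i) \<subseteq> carrier G"
    using F(2) subgroup.subset[OF sub] by blast
  have P_sub: "P \<subseteq> lower_central_series G (Suc i)"
    unfolding P_def using F' lower_central_series_Suc_subset
    by (intro generate_subgroup_incl[OF _ sub]) blast
  have "subgroup P G"
    unfolding P_def using F' subgroup.subset[OF sub] by (intro generate_is_subgroup) blast
  then interpret P: subgroup P G .
  have P_lcs: "lower_central_series G (Suc (Suc i)) \<subseteq> P" and P_F': "F' \<subseteq> P"
    by (auto simp: P_def intro: generate.incl)
  \<comment> \<open>\<open>P\<close> is normal: it lies between two consecutive terms, so
    conjugation changes its elements by members of the smaller term.\<close>
  have conj: "y \<otimes> p \<otimes> inv y \<in> P" if "p \<in> P" "y \<in> carrier G" for p y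
    using that P_sub P_lcs commutator_in_lower_central_series[of p "Suc i" y] conj_eq_commutator[of p y]
    by (metis P.m_closed P.m_inv_closed P.mem_carrier subsetD)
  \<comment> \<open>As \<open>P\<close> is normal, the product and inverse rules for commutators
    extend membership in \<open>P\<close> from generators to all elements, first in the right
    argument and then in the left one.\<close>
  have right: "commutator G x y \<in> P" if x: "x \<in> F" and y: "y \<in> generate G S" for x y
    using y
  proof induction
    case one
    show ?case using x Fcarr by auto
  next
    case (incl s)
    then show ?case using x P_F' by (force simp: F'_def)
  next
    case (inv s)
    then have "commutator G x s \<in> P" using x P_F' by (force simp: F'_def)
    moreover have "x \<in> carrier G" "s \<in> carrier G" using inv x Fcarr S(2) by auto
    ultimately show ?case
      using conj[of "inv (commutator G x s)" "inv s"] commutator_inv_right[of x s] by simp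
  next
    case (eng h1 h2)
    then have "h1 \<in> carrier G" "h2 \<in> carrier G" using S(3) by auto
    moreover have "x \<in> carrier G" using x Fcarr by blast
    ultimately show ?case
      using eng.IH conj[of "commutator G x h2" h1] commutator_mult_right[of x h1 h2] by simp
  qed
  have left: "commutator G x y \<in> P"
    if x: "x \<in> generate G (F \<union> lower_central_series G (Suc i))" and y: "y \<in> carrier G" for x y
    using x
  proof induction
    case one
    show ?case using y by auto
  next
    case (incl h)
    then show ?case using right y S(3) P_lcs commutator_in_lower_central_series by blast
  next
    case (inv h)
    then have "commutator G h y \<in> P"
      using right y S(3) P_lcs commutator_in_lower_central_series by blast
    moreover have "h \<in> carrier G" using inv Fcarr by blast
    ultimately show ?case
      using conj[of "inv (commutator G h y)" "inv h"] commutator_inv_left[of h y] y by simp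
  next
    case (eng h1 h2)
    then have "h1 \<in> carrier G" "h2 \<in> carrier G" using generate_in_carrier[OF Fcarr] by auto
    then show ?case
      using eng.IH y conj[of "commutator G h2 y" h1] commutator_mult_left[of h1 h2 y] by simp
  qed
  have "lower_central_series G (Suc i) \<subseteq> P"
    unfolding lower_central_series_Suc[of i]
    using left F(3) by (intro generate_subgroup_incl[OF _ P.subgroup_axioms]) blast
  moreover have "finite F'" using F(1) S(1) by (simp add: F'_def)
  ultimately show ?case using F' unfolding P_def by blast
qed

end

text \<open>By commutativity the subgroup generated by \<open>insert q Q\<close> is contained in the
  product of the one generated by \<open>Q\<close> and the finite cyclic one generated by
  \<open>q\<close>.\<close>

lemma (in comm_group) finite_generate_torsion:
  assumes "finite Q" "Q \<subseteq> carrier G" "\<And>q. q \<in> Q \<Longrightarrow> \<exists>n>0. q [^] (n::nat) = \<one>"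
  shows "finite (generate G Q)"
  using assms
proof (induction Q rule: finite_induct)
  case empty
  show ?case by (simp add: generate_empty)
next
  case (insert q Q)
  have carr: "q \<in> carrier G" "Q \<subseteq> carrier G" using insert.prems by auto
  have "\<exists>n. n \<noteq> 0 \<and> q [^] (n::nat) = \<one>" using insert.prems(2)[of q] by auto
  then have finq: "finite (generate G {q})"
    using finite_cyclic_subgroup[OF carr(1)] carr(1) by (simp add: carrier_subgroup_generated Int_absorb1)
  have finQ: "finite (generate G Q)" using insert by auto
  have gc: "generate G Q \<subseteq> carrier G" "generate G {q} \<subseteq> carrier G"
    using carr generate_incl by auto
  have "h \<in> generate G Q <#> generate G {q}" if "h \<in> generate G (insert q Q)" for h
    using that
  proof induction
    case one
    show ?case unfolding set_mult_def using generate.one[of G Q] generate.one[of G "{q}"] by force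
  next
    case (incl h)
    then show ?case unfolding set_mult_def
      using generate.one[of G Q] generate.one[of G "{q}"] generate.incl[of h Q G] generate.incl[of q "{q}" G] carr by force
  next
    case (inv h)
    then show ?case unfolding set_mult_def
      using generate.one[of G Q] generate.one[of G "{q}"] generate.inv[of h Q G] generate.inv[of q "{q}" G] carr by force
  next
    case (eng h1 h2)
    then obtain x1 y1 x2 y2 where h: "h1 = x1 \<otimes> y1" "h2 = x2 \<otimes> y2"
      "x1 \<in> generate G Q" "x2 \<in> generate G Q" "y1 \<in> generate G {q}" "y2 \<in> generate G {q}"
      unfolding set_mult_def by auto
    then have "h1 \<otimes> h2 = (x1 \<otimes> x2) \<otimes> (y1 \<otimes> y2)" using gc by (simp add: subset_iff m_ac)
    moreover have "x1 \<otimes> x2 \<in> generate G Q" "y1 \<otimes> y2 \<in> generate G {q}"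
      using h by (auto intro: generate.eng)
    ultimately show ?case unfolding set_mult_def by blast
  qed
  then have "generate G (insert q Q) \<subseteq> generate G Q <#> generate G {q}" by blast
  moreover have "finite (generate G Q <#> generate G {q})"
    unfolding set_mult_def using finQ finq by simp
  ultimately show ?case by (rule finite_subset)
qed

section \<open>Subgroups of finite index\<close>

context group begin

lemma finite_index_transversal:
  assumes "finite_index_subgroup K G"
  obtains T where "finite T" "T \<subseteq> carrier G" "\<And>g. g \<in> carrier G \<Longrightarrow> \<exists>k\<in>K. \<exists>t\<in>T. g = k \<otimes> t"
proof -
  have K: "subgroup K G" and fin: "finite ((\<lambda>g. K #> g) ` carrier G)"
    using assms by (auto simp: finite_index_subgroup_def RCOSETS_def UNION_singleton_eq_range)
  obtain T where T: "T \<subseteq> carrier G" "finite T" "(\<lambda>g. K #> g) ` carrier G = (\<lambda>g. K #> g) ` T"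
    using finite_subset_image[OF fin subset_refl] by blast
  have "\<exists>k\<in>K. \<exists>t\<in>T. g = k \<otimes> t" if "g \<in> carrier G" for g
  proof -
    obtain t where "t \<in> T" "K #> g = K #> t" using T(3) \<open>g \<in> carrier G\<close> by blast
    then show ?thesis using rcos_self[OF \<open>g \<in> carrier G\<close> K] by (auto simp: r_coset_def)
  qed
  with T that show ?thesis by blast
qed

lemma finite_index_of_transversal:
  assumes K: "subgroup K G" and T: "finite T" "T \<subseteq> carrier G"
    and cover: "\<And>g. g \<in> carrier G \<Longrightarrow> \<exists>k\<in>K. \<exists>t\<in>T. g = k \<otimes> t"
  shows "finite_index_subgroup K G"
proof -
  have "K #> g \<in> (\<lambda>t. K #> t) ` T" if "g \<in> carrier G" for g
  proof -
    obtain k t where kt: "k \<in> K" "t \<in> T" "g = k \<otimes> t" using cover[OF \<open>g \<in> carrier G\<close>] by blast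
    then have "K #> g = (K #> k) #> t"
      using T K coset_mult_assoc by (simp add: subset_iff subgroup.mem_carrier subgroup.subset)
    then show ?thesis using kt coset_join2[OF _ K] subgroup.mem_carrier[OF K] by auto
  qed
  then have "rcosets K \<subseteq> (\<lambda>t. K #> t) ` T" by (auto simp: RCOSETS_def)
  then show ?thesis
    using K finite_subset[OF _ finite_imageI[OF T(1)]] by (simp add: finite_index_subgroup_def)
qed

text \<open>Elements with the same value of \<open>f\<close> lie in the same right coset, so
  representatives of the finitely many values meet every coset.\<close>

lemma finite_index_of_fibres:
  assumes K: "subgroup K G" and fin: "finite (f ` carrier G)"
    and fibre: "\<And>g h. g \<in> carrier G \<Longrightarrow> h \<in> carrier G \<Longrightarrow> f g = f h \<Longrightarrow> g \<otimes> inv h \<in> K"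
  shows "finite_index_subgroup K G"
proof -
  obtain T where T: "T \<subseteq> carrier G" "finite T" "f ` carrier G = f ` T"
    using finite_subset_image[OF fin subset_refl] by blast
  show ?thesis
  proof (rule finite_index_of_transversal[OF K T(2,1)])
    fix g assume g: "g \<in> carrier G"
    then obtain t where t: "t \<in> T" "f g = f t" using T(3) by blast
    then have "g \<otimes> inv t \<in> K" "g = (g \<otimes> inv t) \<otimes> t" using fibre g T(1) by (auto simp: m_assoc)
    with t show "\<exists>k\<in>K. \<exists>t\<in>T. g = k \<otimes> t" by blast
  qed
qed

lemma finite_index_trans:
  assumes K: "finite_index_subgroup K G" and L: "finite_index_subgroup L (G\<lparr>carrier := K\<rparr>)"
  shows "finite_index_subgroup L G"
proof -
  have Ks: "subgroup K G" using K by (simp add: finite_index_subgroup_def)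
  interpret K: group "G\<lparr>carrier := K\<rparr>" using Ks by (rule subgroup_imp_group)
  have Ls: "subgroup L G"
    using L incl_subgroup[OF Ks] by (simp add: finite_index_subgroup_def)
  obtain T where T: "finite T" "T \<subseteq> carrier G" "\<And>g. g \<in> carrier G \<Longrightarrow> \<exists>k\<in>K. \<exists>t\<in>T. g = k \<otimes> t"
    using finite_index_transversal[OF K] by blast
  obtain U where U: "finite U" "U \<subseteq> K" "\<And>g. g \<in> K \<Longrightarrow> \<exists>l\<in>L. \<exists>u\<in>U. g = l \<otimes> u"
    using K.finite_index_transversal[OF L] by auto
  have UG: "U \<subseteq> carrier G" using U(2) subgroup.subset[OF Ks] by blast
  show ?thesis
  proof (rule finite_index_of_transversal[OF Ls, of "(\<lambda>(u, t). u \<otimes> t) ` (U \<times> T)"])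
    fix g assume "g \<in> carrier G"
    then obtain k t where kt: "k \<in> K" "t \<in> T" "g = k \<otimes> t" using T(3) by blast
    then obtain l u where lu: "l \<in> L" "u \<in> U" "k = l \<otimes> u" using U(3) by blast
    then have "g = l \<otimes> (u \<otimes> t)"
      using kt T(2) UG subgroup.mem_carrier[OF Ls] by (simp add: m_assoc subset_iff)
    with kt lu show "\<exists>l\<in>L. \<exists>t\<in>(\<lambda>(u, t). u \<otimes> t) ` (U \<times> T). g = l \<otimes> t" by fast
  qed (use T UG U(1) in auto)
qed

text \<open>Schreier's lemma. Multiplying by one letter at a time keeps an element in the product of
  \<open>U\<close> and \<open>T\<close>; if the element belongs to \<open>K\<close>, its factor from
  \<open>T\<close> lies in \<open>K\<close> too, hence in \<open>U\<close>.\<close>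

lemma finitely_generated_finite_index:
  assumes fg: "finitely_generated G" and K: "finite_index_subgroup K G"
  shows "finitely_generated (G\<lparr>carrier := K\<rparr>)"
proof -
  have Ks: "subgroup K G" using K by (simp add: finite_index_subgroup_def)
  obtain S where S: "finite S" "S \<subseteq> carrier G" "generate G S = carrier G"
    using fg by (auto simp: finitely_generated_def)
  obtain T where T: "finite T" "T \<subseteq> carrier G" "\<And>g. g \<in> carrier G \<Longrightarrow> \<exists>k\<in>K. \<exists>t\<in>T. g = k \<otimes> t"
    using finite_index_transversal[OF K] by blast
  \<comment> \<open>Schreier generators; \<open>K \<inter> T\<close> is added since \<open>T\<close> need not contain \<open>\<one>\<close>.\<close>
  define S' where "S' = S \<union> m_inv G ` S"
  define R where "R = K \<inter> (T \<union> (\<lambda>(t, s, t'). t \<otimes> s \<otimes> inv t') ` (T \<times> S' \<times> T))"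
  have RK: "R \<subseteq> K" by (auto simp: R_def)
  then have Rc: "R \<subseteq> carrier G" using subgroup.subset[OF Ks] by blast
  define U where "U = generate G R"
  have UK: "U \<subseteq> K" unfolding U_def using RK by (rule generate_subgroup_incl[OF _ Ks])
  interpret U: subgroup U G unfolding U_def using Rc by (rule generate_is_subgroup)
  have RU: "R \<subseteq> U" by (auto simp: U_def intro: generate.incl)
  have step: "\<exists>u\<in>U. \<exists>t\<in>T. h \<otimes> s = u \<otimes> t"
    if h: "\<exists>u\<in>U. \<exists>t\<in>T. h = u \<otimes> t" and s: "s \<in> S'" for h s
  proof -
    obtain u t where ut: "u \<in> U" "t \<in> T" "h = u \<otimes> t" using h by blast
    have carr: "s \<in> carrier G" "t \<in> carrier G" "u \<in> carrier G"
      using s S(2) T(2) ut by (auto simp: S'_def)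
    obtain k t' where kt: "k \<in> K" "t' \<in> T" "t \<otimes> s = k \<otimes> t'" using T(3)[of "t \<otimes> s"] carr by auto
    have carr': "k \<in> carrier G" "t' \<in> carrier G"
      using kt T(2) subgroup.mem_carrier[OF Ks] by auto
    then have "k = t \<otimes> s \<otimes> inv t'" by (simp add: kt(3) m_assoc)
    then have "k \<in> R" using kt ut s by (force simp: R_def)
    then have "u \<otimes> k \<in> U" using ut RU by blast
    moreover have "h \<otimes> s = u \<otimes> k \<otimes> t'"
      using carr carr' kt(3) by (simp add: ut(3) m_assoc)
    ultimately show ?thesis using kt(2) by blast
  qed
  have reach: "\<exists>u\<in>U. \<exists>t\<in>T. h \<otimes> g = u \<otimes> t"
    if "g \<in> generate G S" and "h \<in> carrier G" "\<exists>u\<in>U. \<exists>t\<in>T. h = u \<otimes> t" for g h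
    using that
  proof (induction arbitrary: h)
    case (eng g1 g2)
    then have carr: "g1 \<in> carrier G" "g2 \<in> carrier G" using S(3) by auto
    then show ?case using eng.IH(2)[of "h \<otimes> g1"] eng.IH(1)[of h] eng.prems by (simp add: m_assoc)
  next
    case (incl s)
    then have "s \<in> S'" by (simp add: S'_def)
    then show ?case using step incl.prems by blast
  next
    case (inv s)
    then have "inv s \<in> S'" by (simp add: S'_def)
    then show ?case using step inv.prems by blast
  next
    case one
    then show ?case by (metis r_one)
  qed
  have "K \<subseteq> U"
  proof
    fix k assume k: "k \<in> K"
    \<comment> \<open>The starting point \<open>\<one>\<close> must itself lie in the product of
      \<open>U\<close> and \<open>T\<close>: its representative belongs to \<open>K\<close>, hence
      to \<open>R\<close>.\<close>
    obtain k0 t0 where t0: "k0 \<in> K" "t0 \<in> T" "\<one> = k0 \<otimes> t0" using T(3)[of \<one>] by auto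
    have "t0 = inv k0"
      using t0 T(2) subgroup.mem_carrier[OF Ks] by (metis inv_equality inv_inv inv_closed subsetD)
    then have "t0 \<in> U" using t0 RU subgroup.m_inv_closed[OF Ks] by (auto simp: R_def)
    then have "\<exists>u\<in>U. \<exists>t\<in>T. \<one> = u \<otimes> t" using t0 T(2) by (metis U.m_inv_closed l_inv subsetD)
    then obtain u t where ut: "u \<in> U" "t \<in> T" "k = u \<otimes> t"
      using reach[of k \<one>] S(3) subgroup.mem_carrier[OF Ks k] by auto
    then have "t = inv u \<otimes> k" using T(2) by auto
    then have "t \<in> K" using ut UK k Ks by (metis subgroup.m_closed subgroup.m_inv_closed subsetD)
    then have "t \<in> U" using ut RU by (auto simp: R_def)
    then show "k \<in> U" using ut by simp
  qed
  then have "generate (G\<lparr>carrier := K\<rparr>) R = K"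
    using UK generate_consistent[OF RK Ks] by (simp add: U_def)
  moreover have "finite R" using S(1) T(1) by (simp add: R_def S'_def)
  ultimately show ?thesis using RK by (auto simp: finitely_generated_def)
qed

lemma virtually_abelian_finite_index:
  assumes K: "finite_index_subgroup K G" and "virtually_abelian (G\<lparr>carrier := K\<rparr>)"
  shows "virtually_abelian G"
  using assms finite_index_trans[OF K] unfolding virtually_abelian_def by auto

lemma virtually_abelian_if_comm:
  assumes "\<And>x y. x \<in> carrier G \<Longrightarrow> y \<in> carrier G \<Longrightarrow> x \<otimes> y = y \<otimes> x"
  shows "virtually_abelian G"
proof -
  have "comm_group G" using assms by (rule group_comm_groupI)
  moreover have "finite_index_subgroup (carrier G) G"
    by (rule finite_index_of_transversal[OF subgroup_self, of "{\<one>}"]) auto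
  ultimately show ?thesis by (force simp: virtually_abelian_def)
qed

section \<open>Centralizers and the reduction of the nilpotency class\<close>

lemma heis_pair_of_subgroup:
  assumes K: "subgroup K G" and pair: "heis_pair (G\<lparr>carrier := K\<rparr>) a b"
  shows "heis_pair G a b"
proof -
  have ab: "a \<in> K" "b \<in> K" using pair by (auto simp: heis_pair_def)
  then show ?thesis
    using pair commutator_consistent[OF K ab] subgroup.mem_carrier[OF K]
    by (auto simp: heis_pair_def simp flip: nat_pow_consistent)
qed

text \<open>Serves for the centre, for the subgroup \<open>K\<close> of the induction and for the
  centralizer of a single element.\<close>

lemma subgroup_centralizer:
  assumes F: "F \<subseteq> carrier G"
  shows "subgroup {y \<in> carrier G. \<forall>x\<in>F. x \<otimes> y = y \<otimes> x} G" (is "subgroup ?C G")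
proof
  fix y assume y: "y \<in> ?C"
  have "x \<otimes> inv y = inv y \<otimes> x" if "x \<in> F" for x
  proof -
    have "x \<otimes> y = y \<otimes> x" "x \<in> carrier G" "y \<in> carrier G" using that y F by auto
    then show ?thesis by (simp add: inv_solve_left inv_solve_right flip: m_assoc)
  qed
  then show "inv y \<in> ?C" using y by simp
next
  fix y z assume yz: "y \<in> ?C" "z \<in> ?C"
  have "x \<otimes> (y \<otimes> z) = y \<otimes> z \<otimes> x" if "x \<in> F" for x
  proof -
    have "x \<otimes> y = y \<otimes> x" "x \<otimes> z = z \<otimes> x" "x \<in> carrier G" "y \<in> carrier G" "z \<in> carrier G"
      using that yz F by auto
    then show ?thesis by (metis m_assoc)
  qed
  then show "y \<otimes> z \<in> ?C" using yz by simp
qed (use F in auto)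

text \<open>The values are central, so \<open>commutator G x\<close> is a homomorphism into the
  centre; its image is generated by the finitely many torsion elements
  \<open>commutator G x s\<close> with \<open>s\<close> in \<open>S\<close>.\<close>

lemma finite_commutators:
  assumes S: "finite S" "S \<subseteq> carrier G" "generate G S = carrier G"
    and x: "x \<in> carrier G"
    and central: "\<And>y z. y \<in> carrier G \<Longrightarrow> z \<in> carrier G \<Longrightarrow> commutator G x y \<otimes> z = z \<otimes> commutator G x y"
    and torsion: "\<And>y. y \<in> carrier G \<Longrightarrow> \<exists>n>0. commutator G x y [^] (n::nat) = \<one>"
  shows "finite (commutator G x ` carrier G)"
proof -
  define Z where "Z = {z \<in> carrier G. \<forall>y\<in>carrier G. y \<otimes> z = z \<otimes> y}"
  have Z: "subgroup Z G" unfolding Z_def by (rule subgroup_centralizer) simp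
  have "z \<otimes> w = w \<otimes> z" if "z \<in> Z" "w \<in> Z" for z w
    using that unfolding Z_def by blast
  then interpret Z: comm_group "G\<lparr>carrier := Z\<rparr>"
    using subgroup_imp_group[OF Z] by (intro group.group_comm_groupI) auto
  have inZ: "commutator G x y \<in> Z" if "y \<in> carrier G" for y
    using central[OF that, symmetric] commutator_closed[OF x that] unfolding Z_def by blast
  have "commutator G x \<in> hom G (G\<lparr>carrier := Z\<rparr>)"
  proof (rule homI)
    fix y z assume yz: "y \<in> carrier G" "z \<in> carrier G"
    then have "y \<otimes> commutator G x z \<otimes> inv y = commutator G x z"
      using x yz central[of z y] inv_solve_right'[of "commutator G x z" "y \<otimes> commutator G x z" y]
      by simp
    then show "commutator G x (y \<otimes> z) = commutator G x y \<otimes>\<^bsub>G\<lparr>carrier := Z\<rparr>\<^esub> commutator G x z"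
      using yz x by (simp add: commutator_mult_right)
  qed (simp add: inZ)
  then interpret h: group_hom G "G\<lparr>carrier := Z\<rparr>" "commutator G x"
    by unfold_locales
  have "finite (generate (G\<lparr>carrier := Z\<rparr>) (commutator G x ` S))"
  proof (rule Z.finite_generate_torsion)
    fix q assume "q \<in> commutator G x ` S"
    then show "\<exists>n>0. q [^]\<^bsub>G\<lparr>carrier := Z\<rparr>\<^esub> (n::nat) = \<one>\<^bsub>G\<lparr>carrier := Z\<rparr>\<^esub>"
      using torsion S(2) by (auto simp flip: nat_pow_consistent)
  qed (use S inZ in auto)
  then show ?thesis using h.generate_img[OF S(2)] S(3) by simp
qed

end

text \<open>Induction on the length of the series with \<open>G\<close> arbitrary, since the step
  passes to a subgroup \<open>K\<close>.\<close>

lemma heis_pair_or_virtually_abelian: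
  fixes G :: "('a, 'm) monoid_scheme"
  assumes "group G" "finitely_generated G" "lower_central_series G m = {\<one>\<^bsub>G\<^esub>}"
  shows "(\<exists>a b. heis_pair G a b) \<or> virtually_abelian G"
  using assms
proof (induction m arbitrary: G)
  case 0
  then interpret group G by simp
  have "carrier G = {\<one>\<^bsub>G\<^esub>}" using 0 by simp
  then have "virtually_abelian G" by (intro virtually_abelian_if_comm) simp
  then show ?case ..
next
  case (Suc m)
  then interpret group G by simp
  show ?case
  proof (cases m)
    case 0
    have "x \<otimes>\<^bsub>G\<^esub> y = y \<otimes>\<^bsub>G\<^esub> x" if "x \<in> carrier G" "y \<in> carrier G" for x y
      using commutator_in_lower_central_series[of x 0 y] Suc.prems(3) 0 that
      by (simp add: commutator_eq_one_iff)
    then have "virtually_abelian G" by (rule virtually_abelian_if_comm)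
    then show ?thesis ..
  next
    case m: (Suc j)
    note sub = subgroup_lower_central_series
    show ?thesis
    proof (subst disj_commute, rule disjCI)
      assume no_pair: "\<nexists>a b. heis_pair G a b"
      obtain S where S: "finite S" "S \<subseteq> carrier G" "generate G S = carrier G"
        using Suc.prems(2) by (auto simp: finitely_generated_def)
      obtain F where F: "finite F" "F \<subseteq> lower_central_series G j"
        "lower_central_series G j \<subseteq> generate G (F \<union> lower_central_series G m)"
        using lower_central_series_finite_generation[OF S, of j] m by blast
      have Fc: "F \<subseteq> carrier G" using F(2) subgroup.subset[OF sub] by blast
      have central: "z \<otimes>\<^bsub>G\<^esub> y = y \<otimes>\<^bsub>G\<^esub> z"
        if "z \<in> lower_central_series G m" "y \<in> carrier G" for y z
        using commutator_in_lower_central_series[OF that] Suc.prems(3) that subgroup.mem_carrier[OF sub]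
        by (simp add: commutator_eq_one_iff del: lower_central_series.simps)
      have comm: "commutator G x y \<in> lower_central_series G m"
        if "x \<in> lower_central_series G j" "y \<in> carrier G" for x y
        using commutator_in_lower_central_series[OF that] m by simp
      \<comment> \<open>\<open>commutator G x y\<close> is central, so with infinite order it would
        make \<open>x\<close> and \<open>y\<close> a Heisenberg pair.\<close>
      have "\<exists>n>0. commutator G x y [^]\<^bsub>G\<^esub> (n::nat) = \<one>\<^bsub>G\<^esub>"
        if "x \<in> lower_central_series G j" "y \<in> carrier G" for x y
        using no_pair that comm[OF that] central subgroup.mem_carrier[OF sub]
        unfolding heis_pair_def by metis
      then have fin: "finite (commutator G x ` carrier G)" if "x \<in> F" for x
        using that F(2) Fc comm central by (intro finite_commutators[OF S]) blast+
      \<comment> \<open>\<open>K\<close> centralizes all of \<open>\<gamma>\<^sub>j(G)\<close>, so its nilpotency class is smaller than that of \<open>G\<close>.\<close>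
      define K where "K = {y \<in> carrier G. \<forall>x\<in>F. x \<otimes>\<^bsub>G\<^esub> y = y \<otimes>\<^bsub>G\<^esub> x}"
      have K: "subgroup K G" unfolding K_def by (rule subgroup_centralizer[OF Fc])
      have index: "finite_index_subgroup K G"
      \<comment> \<open>Elements having the same commutators with all of \<open>F\<close> differ by
        an element of \<open>K\<close>, and only finitely many families of commutators
        occur.\<close>
      proof (rule finite_index_of_fibres[OF K, of "\<lambda>y. \<lambda>x\<in>F. commutator G x y"])
        have "(\<lambda>y. \<lambda>x\<in>F. commutator G x y) ` carrier G \<subseteq> (\<Pi>\<^sub>E x\<in>F. commutator G x ` carrier G)"
          by auto
        then show "finite ((\<lambda>y. \<lambda>x\<in>F. commutator G x y) ` carrier G)"
          by (rule finite_subset) (intro finite_PiE F(1) fin)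
      next
        fix g h
        assume gh: "g \<in> carrier G" "h \<in> carrier G"
          "(\<lambda>x\<in>F. commutator G x g) = (\<lambda>x\<in>F. commutator G x h)"
        have "x \<otimes>\<^bsub>G\<^esub> (g \<otimes>\<^bsub>G\<^esub> inv\<^bsub>G\<^esub> h) = g \<otimes>\<^bsub>G\<^esub> inv\<^bsub>G\<^esub> h \<otimes>\<^bsub>G\<^esub> x" if x: "x \<in> F" for x
        proof -
          have xc: "x \<in> carrier G" using x Fc by blast
          have eq: "commutator G x g = commutator G x h" using gh(3) x by (metis restrict_apply')
          have comm_c: "commutator G x h \<otimes>\<^bsub>G\<^esub> y = y \<otimes>\<^bsub>G\<^esub> commutator G x h" if "y \<in> carrier G" for y
            using comm central x F(2) gh that by blast
          have conj: "y \<otimes>\<^bsub>G\<^esub> inv\<^bsub>G\<^esub> (commutator G x h) \<otimes>\<^bsub>G\<^esub> inv\<^bsub>G\<^esub> y = inv\<^bsub>G\<^esub> (commutator G x h)"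
            if y: "y \<in> carrier G" for y
          proof -
            have "y \<otimes>\<^bsub>G\<^esub> inv\<^bsub>G\<^esub> (commutator G x h) \<otimes>\<^bsub>G\<^esub> inv\<^bsub>G\<^esub> y
              = inv\<^bsub>G\<^esub> (y \<otimes>\<^bsub>G\<^esub> commutator G x h \<otimes>\<^bsub>G\<^esub> inv\<^bsub>G\<^esub> y)"
              using y xc gh by (simp add: inv_mult_group m_assoc)
            also have "y \<otimes>\<^bsub>G\<^esub> commutator G x h \<otimes>\<^bsub>G\<^esub> inv\<^bsub>G\<^esub> y = commutator G x h"
              using y xc gh comm_c[OF y]
                inv_solve_right'[of "commutator G x h" "y \<otimes>\<^bsub>G\<^esub> commutator G x h" y] by simp
            finally show ?thesis .
          qed
          have "commutator G x (g \<otimes>\<^bsub>G\<^esub> inv\<^bsub>G\<^esub> h) = \<one>\<^bsub>G\<^esub>"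
            using xc gh by (simp only: commutator_mult_right commutator_inv_right inv_closed eq conj
                r_inv commutator_closed)
          then show ?thesis using xc gh by (simp add: commutator_eq_one_iff)
        qed
        then show "g \<otimes>\<^bsub>G\<^esub> inv\<^bsub>G\<^esub> h \<in> K" using gh by (simp add: K_def)
      qed
      interpret K: group "G\<lparr>carrier := K\<rparr>" using K by (rule subgroup_imp_group)
      have "commutator (G\<lparr>carrier := K\<rparr>) x y = \<one>\<^bsub>G\<^esub>"
        if x: "x \<in> lower_central_series (G\<lparr>carrier := K\<rparr>) j" and y: "y \<in> K" for x y
      proof -
        have yc: "y \<in> carrier G" using y by (simp add: K_def)
        have xK: "x \<in> K" using x subgroup.subset[OF K.subgroup_lower_central_series] by auto
        \<comment> \<open>\<open>y\<close> commutes with \<open>F\<close> by definition of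
          \<open>K\<close> and with term \<open>m\<close> because that term is central, hence with
          the subgroup they generate, which contains term \<open>j\<close> of
          \<open>G\<close>.\<close>
        have "x \<in> generate G (F \<union> lower_central_series G m)"
          using x lower_central_series_subgroup_mono[OF K] F(3) by blast
        moreover have "F \<union> lower_central_series G m \<subseteq> {z \<in> carrier G. \<forall>w\<in>{y}. w \<otimes>\<^bsub>G\<^esub> z = z \<otimes>\<^bsub>G\<^esub> w}"
        proof
          fix z assume z: "z \<in> F \<union> lower_central_series G m"
          then have "y \<otimes>\<^bsub>G\<^esub> z = z \<otimes>\<^bsub>G\<^esub> y"
            using y central[OF _ yc] unfolding K_def by (metis (mono_tags, lifting) Un_iff mem_Collect_eq)
          then show "z \<in> {z \<in> carrier G. \<forall>w\<in>{y}. w \<otimes>\<^bsub>G\<^esub> z = z \<otimes>\<^bsub>G\<^esub> w}"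
            using z Fc subgroup.subset[OF sub, of m] by blast
        qed
        then have "generate G (F \<union> lower_central_series G m)
            \<subseteq> {z \<in> carrier G. \<forall>w\<in>{y}. w \<otimes>\<^bsub>G\<^esub> z = z \<otimes>\<^bsub>G\<^esub> w}"
          using yc by (intro generate_subgroup_incl[OF _ subgroup_centralizer]) auto
        ultimately have "x \<otimes>\<^bsub>G\<^esub> y = y \<otimes>\<^bsub>G\<^esub> x" by auto
        then have "commutator G x y = \<one>\<^bsub>G\<^esub>"
          using xK yc subgroup.mem_carrier[OF K] by (simp add: commutator_eq_one_iff)
        then show ?thesis by (simp add: commutator_consistent[OF K xK y])
      qed
      then have "lower_central_series (G\<lparr>carrier := K\<rparr>) m \<subseteq> {\<one>\<^bsub>G\<^esub>}"
        unfolding m K.lower_central_series_Suc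
        by (intro K.generate_subgroup_incl[OF _ K.triv_subgroup, simplified]) auto
      then have "lower_central_series (G\<lparr>carrier := K\<rparr>) m = {\<one>\<^bsub>G\<lparr>carrier := K\<rparr>\<^esub>}"
        using subgroup.one_closed[OF K.subgroup_lower_central_series, of m] by auto
      then have "(\<exists>a b. heis_pair (G\<lparr>carrier := K\<rparr>) a b) \<or> virtually_abelian (G\<lparr>carrier := K\<rparr>)"
        by (intro Suc.IH K.is_group finitely_generated_finite_index[OF Suc.prems(2) index])
      then show "virtually_abelian G"
        using no_pair heis_pair_of_subgroup[OF K] virtually_abelian_finite_index[OF index] by blast
    qed
  qed
qed

theorem proposition3p8:
  fixes G :: "('a, 'm) monoid_scheme"
  assumes "group G"
    and "finitely_generated G"
    and "virtually_nilpotent G"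
    and "\<not> virtually_abelian G"
  shows "(\<forall>H. subgroup H G \<and> G\<lparr>carrier := H\<rparr> \<cong> heisenberg_group \<longrightarrow>
            non_foldable TYPE('x) G H) \<and>
         has_schreier_growth_gap TYPE('x) G (\<lambda>n. real n ^ 4)"
proof
  interpret group G by fact
  show "\<forall>H. subgroup H G \<and> G\<lparr>carrier := H\<rparr> \<cong> heisenberg_group \<longrightarrow> non_foldable TYPE('x) G H"
    using non_foldable_heisenberg[OF assms(1)] by blast
  obtain K where K: "finite_index_subgroup K G" "nilpotent_group (G\<lparr>carrier := K\<rparr>)"
    using assms(3) by (auto simp: virtually_nilpotent_def)
  obtain m where m: "group (G\<lparr>carrier := K\<rparr>)"
    "lower_central_series (G\<lparr>carrier := K\<rparr>) m = {\<one>\<^bsub>G\<lparr>carrier := K\<rparr>\<^esub>}"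
    using K(2) unfolding nilpotent_group_def by blast
  \<comment> \<open>An abelian subgroup of finite index in \<open>K\<close> would also have finite
    index in \<open>G\<close>.\<close>
  have "\<not> virtually_abelian (G\<lparr>carrier := K\<rparr>)"
    using virtually_abelian_finite_index[OF K(1)] assms(4) by blast
  then obtain a b where "heis_pair (G\<lparr>carrier := K\<rparr>) a b"
    using heis_pair_or_virtually_abelian[OF m(1) _ m(2)]
      finitely_generated_finite_index[OF assms(2) K(1)] by blast
  then have "heis_pair G a b"
    using heis_pair_of_subgroup K(1) unfolding finite_index_subgroup_def by blast
  then show "has_schreier_growth_gap TYPE('x) G (\<lambda>n. real n ^ 4)"
    unfolding has_schreier_growth_gap_def using growth_of_heis_pair by blast
qed

end
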